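(* Let $K=\mathbf{C}((z))$ (the formal case) and let $P=a_n\sigma_q^n+\cdots+a_0$ with $a_i\in K$, $a_0a_n\neq 0$, all of whose slopes are integers. Then the $q$-difference equation $P.f=a_n\sigma_q^nf+\cdots+a_0f=0$ admits $n$ solutions in $L$ that are linearly independent over the field of constants $C_L=L^{\sigma_q}$.
   Context: Fix $q\in\mathbf{C}$ with $|q|>1$. On $K=\mathbf{C}((z))$ let $\sigma_q:f(z)\mapsto f(qz)$ and let $v_0$ be the $z$-adic valuation. The $K$-algebra $L$ is obtained from $K$ by adjoining symbols $e_{q,c}$ ($c\in\mathbf{C}^*$), an invertible symbol $\Theta_q$, and a symbol $l_q$, subject to the relations $e_{q,c}e_{q,d}=e_{q,cd}$, $e_{q,1}=1$, $e_{q,q}=z$; $\sigma_q$ is extended to an automorphism of $L$ by $\sigma_q e_{q,c}=c\,e_{q,c}$, $\sigma_q\Theta_q=z\Theta_q$, $\sigma_q l_q=l_q+1$. The constants $C_L=L^{\sigma_q}$ of $L$ are the elements fixed by $\sigma_q$ (in this case $C_L=\mathbf{C}$). Slopes of $P$: the Newton polygon $N(P)$ is the convex hull of $\{(i,j)\in\mathbf{Z}^2: j\ge v_0(a_i)\}$; its boundary consists of two vertical half-lines and of finitely many non-vertical edges, whose slopes are the slopes of $P$. *)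

theory Defs
  imports
    "HOL-Analysis.Polytope"
    "HOL-Computational_Algebra.Formal_Laurent_Series"
    "HOL-Library.Poly_Mapping"
    "HOL-Algebra.Algebraic_Closure_Type"
    "HOL-Algebra.Embedded_Algebras"
begin

text \<open>The field $K = \mathbf{C}((z))$ is the type \<^typ>\<open>complex fls\<close>, with $z$ being \<^term>\<open>fls_X\<close>
  and the valuation $v_0$ being \<^const>\<open>fls_subdegree\<close> (which, unlike $v_0$, is $0$ rather than
  $\infty$ at the zero series).\<close>

definition sigma_K :: "complex \<Rightarrow> complex fls \<Rightarrow> complex fls" where
  "sigma_K q f = fls_compose_fps f (fps_const q * fps_X)"


section \<open>The algebra L\<close>

text \<open>$L$ is the quotient of the polynomial ring over $K$ in the symbols below by the ideal
  generated by the relations. The invertibility of $\Theta_q$ is imposed by a further symbol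
  for its inverse.\<close>

typedef complex_star = "{c :: complex. c \<noteq> 0}"
  by (rule exI[of _ 1]) simp

datatype symb = E complex_star | Theta | ThetaInv | Ell

type_synonym K_poly = "(symb \<Rightarrow>\<^sub>0 nat) \<Rightarrow>\<^sub>0 complex fls"

abbreviation K_poly_ring :: "K_poly ring" where
  "K_poly_ring \<equiv> ring_of_type_algebra"

definition of_K :: "complex fls \<Rightarrow> K_poly" where
  "of_K x = Poly_Mapping.single 0 x"

definition indet :: "symb \<Rightarrow> K_poly" where
  "indet s = Poly_Mapping.single (Poly_Mapping.single s 1) 1"

definition e_symb :: "complex \<Rightarrow> K_poly" where
  "e_symb c = indet (E (Abs_complex_star c))"  \<comment> \<open>only used for \<^prop>\<open>c \<noteq> 0\<close>\<close>

definition L_rels :: "complex \<Rightarrow> K_poly set" where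
  "L_rels q =
     {e_symb c * e_symb d - e_symb (c * d) | c d. c \<noteq> 0 \<and> d \<noteq> 0} \<union>
     {e_symb 1 - 1, e_symb q - of_K fls_X, indet Theta * indet ThetaInv - 1}"

definition L_ideal :: "complex \<Rightarrow> K_poly set" where
  "L_ideal q = Idl\<^bsub>K_poly_ring\<^esub> (L_rels q)"

definition L_ring :: "complex \<Rightarrow> K_poly set ring" where
  "L_ring q = K_poly_ring Quot (L_ideal q)"

definition to_L :: "complex \<Rightarrow> K_poly \<Rightarrow> K_poly set" where
  "to_L q p = L_ideal q +>\<^bsub>K_poly_ring\<^esub> p"


section \<open>The automorphism and the constants of L\<close>

fun sigma_symb :: "symb \<Rightarrow> K_poly" where
  "sigma_symb (E c) = of_K (fls_const (Rep_complex_star c)) * indet (E c)"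
| "sigma_symb Theta = of_K fls_X * indet Theta"
| "sigma_symb ThetaInv = of_K (inverse fls_X) * indet ThetaInv"
| "sigma_symb Ell = indet Ell + 1"

text \<open>The ring endomorphism of the polynomial ring that acts as \<open>sigma_K q\<close> on coefficients
  and as \<^const>\<open>sigma_symb\<close> on the symbols.\<close>

definition sigma_poly :: "complex \<Rightarrow> K_poly \<Rightarrow> K_poly" where
  "sigma_poly q p =
     (\<Sum>m\<in>Poly_Mapping.keys p. of_K (sigma_K q (Poly_Mapping.lookup p m)) *
        (\<Prod>s\<in>Poly_Mapping.keys m. sigma_symb s ^ Poly_Mapping.lookup m s))"

text \<open>The map induced on $L$. As \<open>sigma_poly q\<close> maps \<open>L_ideal q\<close> into itself, all the cosets in
  the following union coincide.\<close>

definition sigma_L :: "complex \<Rightarrow> K_poly set \<Rightarrow> K_poly set" where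
  "sigma_L q x = (\<Union>p\<in>x. to_L q (sigma_poly q p))"

definition constants_L :: "complex \<Rightarrow> K_poly set set" where
  "constants_L q = {x \<in> carrier (L_ring q). sigma_L q x = x}"


section \<open>q-difference operators and slopes\<close>

text \<open>The operator $a_n\sigma_q^n+\cdots+a_0$ is given by \<open>n\<close> and the coefficients \<open>a 0, \<dots>, a n\<close>;
  the values of \<open>a\<close> beyond \<open>n\<close> are not used.\<close>

definition qdiff_apply ::
    "complex \<Rightarrow> nat \<Rightarrow> (nat \<Rightarrow> complex fls) \<Rightarrow> K_poly set \<Rightarrow> K_poly set" where
  "qdiff_apply q n a f =
     (\<Oplus>\<^bsub>L_ring q\<^esub>i\<in>{..n}. to_L q (of_K (a i)) \<otimes>\<^bsub>L_ring q\<^esub> (sigma_L q ^^ i) f)"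

definition newton_polygon :: "nat \<Rightarrow> (nat \<Rightarrow> complex fls) \<Rightarrow> (real \<times> real) set" where
  "newton_polygon n a =
     convex hull {(real i, real_of_int j) | i j. i \<le> n \<and> a i \<noteq> 0 \<and> fls_subdegree (a i) \<le> j}"

text \<open>The vertical half-lines of the boundary are edges in the sense of \<^const>\<open>edge_of\<close>, too;
  the condition \<open>x1 \<noteq> x2\<close> excludes them.\<close>

definition slopes :: "nat \<Rightarrow> (nat \<Rightarrow> complex fls) \<Rightarrow> real set" where
  "slopes n a =
     {(y2 - y1) / (x2 - x1) | x1 y1 x2 y2.
        x1 \<noteq> x2 \<and> (\<exists>e. e edge_of newton_polygon n a \<and> (x1, y1) \<in> e \<and> (x2, y2) \<in> e)}"

end

theory Submission
  imports Defs
begin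

text \<open>At an integral slope \<open>\<mu>\<close> of \<open>P\<close>, the Frobenius method yields a solution
  \<open>y = g(z) e\<^sub>c \<Theta>\<^sup>k\<close> with \<open>k = -\<mu>\<close>, which is a unit of \<open>L\<close>; with \<open>u = \<sigma>(y)/y \<in> K\<close> this
  gives a factorization \<open>P = Q (\<sigma> - u)\<close>, in which the slopes of \<open>Q\<close> are slopes of \<open>P\<close>. Since
  \<open>\<sigma> - 1\<close> is surjective on \<open>L\<close>, so is \<open>\<sigma> - u\<close>. By induction \<open>Q\<close> has \<open>n - 1\<close> independent
  solutions; preimages of these under \<open>\<sigma> - u\<close>, together with \<open>y\<close>, solve \<open>P\<close>, and applying
  \<open>\<sigma> - u\<close> to a linear relation among them shows their independence.\<close>

text \<open>The obstacle is resonance. The recursion for the coefficients of g divides by p(c q^N),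
  where p is the indicial polynomial of an edge; taking c to be a nonzero root of p of largest
  modulus keeps these divisors nonzero for N > 0, because |q| > 1. So one solution without
  logarithms exists at every stage of the induction, and resonance returns only when \<sigma> - u is
  inverted, where powers of l absorb it. Integrality enters through \<Theta>: the twist by
  \<Theta>^k shifts all slopes by an integer, which makes an edge of integral slope horizontal. The
  second obstacle is that L is known only by generators and relations. The existence half needs only
  congruences, but independence needs a bound from below on L. It is reduced to y being nonzero in L
  and, as y is a unit, to 1 being nonzero in L. A single linear functional settles this, in place of
  a normal form for the elements of L.\<close>

section \<open>Laurent series and the operator on K\<close>

text \<open>The integers are not well-founded, but by \<open>bound\<close> the solution may be
  started with zeros below \<open>N\<close>, and from \<open>N\<close> on well-founded recursion
  applies because \<open>G n\<close> reads only earlier coefficients. The zeros below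
  \<open>N\<close> also make the result a Laurent series.\<close>

lemma fls_recursion:
  fixes G :: "int \<Rightarrow> (int \<Rightarrow> 'a::zero) \<Rightarrow> 'a"
  assumes local: "\<And>n h h'. (\<And>m. m < n \<Longrightarrow> h m = h' m) \<Longrightarrow> G n h = G n h'"
    and bound: "\<And>n. n < N \<Longrightarrow> G n (\<lambda>_. 0) = 0"
  obtains h :: "'a fls" where "\<And>n. fls_nth h n = G n (fls_nth h)"
proof -
  define R where "R = {(m, n). N \<le> n \<and> m < (n::int)}"
  define F where "F = (\<lambda>h n. if n < N then 0 else G n h)"
  define h where "h = wfrec R F"
  \<comment> \<open>The \<open>+ 1\<close> in the measure gives \<open>N\<close> the value 1,
    strictly above the value 0 of every \<open>m < N\<close>.\<close>
  have "wf R"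
    by (rule wf_subset[OF wf_measure[of "\<lambda>n. nat (n - N + 1)"]]) (auto simp: R_def)
  moreover have "adm_wf R F"
    unfolding adm_wf_def F_def R_def by (auto intro: local)
  ultimately have "h = F h"
    unfolding h_def by (rule wfrec_fixpoint)
  then have h: "h n = (if n < N then 0 else G n h)" for n
    unfolding F_def by metis
  have nth: "fls_nth (Abs_fls h) = h"
    by (rule ext, rule nth_Abs_fls_lower_bound[of N]) (use h in auto)
  have "h n = G n h" for n
  proof (cases "n < N")
    case True
    have "G n h = G n (\<lambda>_. 0)"
      by (rule local) (use True h in auto)
    with True h bound show ?thesis by simp
  qed (simp add: h)
  with nth that[of "Abs_fls h"] show ?thesis by simp
qed

lemma sigma_K_nth: "q \<noteq> 0 \<Longrightarrow> fls_nth (sigma_K q f) n = fls_nth f n * q powi n"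
  by (simp add: sigma_K_def fls_nth_fls_compose_fps_linear)

lemma sigma_K_0 [simp]: "sigma_K q 0 = 0"
  and sigma_K_1 [simp]: "sigma_K q 1 = 1"
  and sigma_K_const [simp]: "sigma_K q (fls_const c) = fls_const c"
  by (simp_all add: sigma_K_def)

lemma sigma_K_add: "q \<noteq> 0 \<Longrightarrow> sigma_K q (f + g) = sigma_K q f + sigma_K q g"
  by (intro fls_eqI) (simp add: sigma_K_nth algebra_simps)

lemma sigma_K_mult: "q \<noteq> 0 \<Longrightarrow> sigma_K q (f * g) = sigma_K q f * sigma_K q g"
  by (simp add: sigma_K_def fls_compose_fps_mult)

lemma sigma_K_inverse: "q \<noteq> 0 \<Longrightarrow> sigma_K q (inverse f) = inverse (sigma_K q f)"
  by (simp add: sigma_K_def fls_compose_fps_inverse)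

lemma sigma_K_eq_0_iff: "q \<noteq> 0 \<Longrightarrow> sigma_K q f = 0 \<longleftrightarrow> f = 0"
  by (simp add: sigma_K_def fls_compose_fps_eq_0_iff)

lemma sigma_K_X: "sigma_K q fls_X = fls_const q * fls_X"
  by (simp add: sigma_K_def fls_times_fps_to_fls)

lemma subdegree_sigma_K: "q \<noteq> 0 \<Longrightarrow> fls_subdegree (sigma_K q f) = fls_subdegree f"
  by (cases "f = 0") (auto intro!: fls_subdegree_eqI simp: sigma_K_nth nth_fls_subdegree_nonzero)

declare fls_X_power_int [simp del]

lemma fls_X_powi_mult_nth: "fls_nth (fls_X powi k * f) n = fls_nth (f :: complex fls) (n - k)"
  by (simp add: fls_X_power_int fls_X_intpow_times_conv_shift)

text \<open>At index n the equation reads c q^(n-k) h(n-k) - h(n) = f(n) - r(n). For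
  \<open>k = 0\<close> it is diagonal and is obstructed only where c q^n = 1; that part of
  \<open>f\<close> is put into \<open>r\<close>. For other \<open>k\<close>, the one of h(n) and
  h(n-k) with the larger index is determined by the other, and \<open>r = 0\<close>.\<close>

lemma sigma_K_first_order_solvable:
  assumes q: "norm q > 1" and c: "c \<noteq> 0"
  obtains h r where "fls_const c * fls_X powi k * sigma_K q h - h = f - r"
    and "fls_const c * fls_X powi k * sigma_K q r = r"
proof -
  have q0: "q \<noteq> 0" using q by auto
  have shifted: "fls_nth (fls_const c * fls_X powi k * sigma_K q h) n =
      c * fls_nth h (n - k) * q powi (n - k)" for h n
    using q0 by (simp add: mult.assoc fls_X_powi_mult_nth sigma_K_nth)
  consider "k = 0" | "k > 0" | "k < 0" by linarith
  then show ?thesis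
  proof cases
    case 1
    obtain h where h: "fls_nth h n = (if c * q powi n = 1 then 0 else fls_nth f n / (c * q powi n - 1))" for n
      by (rule fls_recursion[of "\<lambda>n _. if c * q powi n = 1 then 0 else fls_nth f n / (c * q powi n - 1)"
            "fls_subdegree f"]) auto
    obtain r where r: "fls_nth r n = (if c * q powi n = 1 then fls_nth f n else 0)" for n
      by (rule fls_recursion[of "\<lambda>n _. if c * q powi n = 1 then fls_nth f n else 0"
            "fls_subdegree f"]) auto
    show ?thesis
    proof (rule that[of h r]; rule fls_eqI)
      fix n
      have "c * q powi n * fls_nth h n - fls_nth h n = fls_nth f n - fls_nth r n"
        by (auto simp: h r divide_simps algebra_simps)
      then show "fls_nth (fls_const c * fls_X powi k * sigma_K q h - h) n = fls_nth (f - r) n"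
        unfolding fls_minus_nth shifted using 1 by (simp add: ac_simps)
      show "fls_nth (fls_const c * fls_X powi k * sigma_K q r) n = fls_nth r n"
        unfolding shifted using 1 by (auto simp: r)
    qed
  next
    case 2
    obtain h where h: "fls_nth h n = c * fls_nth h (n - k) * q powi (n - k) - fls_nth f n" for n
      by (rule fls_recursion[of "\<lambda>n h. c * h (n - k) * q powi (n - k) - fls_nth f n"
            "fls_subdegree f"]) (use 2 in auto)
    show ?thesis
    proof (rule that[of h 0])
      show "fls_const c * fls_X powi k * sigma_K q h - h = f - 0"
        by (rule fls_eqI, unfold fls_minus_nth shifted) (use h in \<open>simp add: algebra_simps\<close>)
    qed simp
  next
    case 3
    \<comment> \<open>The equation at index \<open>n + k\<close>, solved for its top coefficient
      h(n). As h(n) reads f(n + k), the solution starts at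
      \<open>fls_subdegree f - k\<close>.\<close>
    obtain h where h: "fls_nth h n = (fls_nth f (n + k) + fls_nth h (n + k)) / (c * q powi n)" for n
      by (rule fls_recursion[of "\<lambda>n h. (fls_nth f (n + k) + h (n + k)) / (c * q powi n)"
            "fls_subdegree f - k"]) (use 3 in auto)
    show ?thesis
    proof (rule that[of h 0])
      show "fls_const c * fls_X powi k * sigma_K q h - h = f - 0"
      proof (rule fls_eqI, unfold fls_minus_nth shifted)
        fix n
        have "c * fls_nth h (n - k) * q powi (n - k) = fls_nth f n + fls_nth h n"
          using c q0 by (subst h) (simp add: power_int_not_zero)
        then show "c * fls_nth h (n - k) * q powi (n - k) - fls_nth h n = fls_nth f n - fls_nth 0 n"
          by simp
      qed
    qed simp
  qed
qed


section \<open>Polynomials as sums of monomials\<close>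

definition monomial_value :: "('s \<Rightarrow> 'a::comm_monoid_mult) \<Rightarrow> ('s \<Rightarrow>\<^sub>0 nat) \<Rightarrow> 'a" where
  "monomial_value t m = (\<Prod>s\<in>Poly_Mapping.keys m. t s ^ Poly_Mapping.lookup m s)"

lemma monomial_value_0 [simp]: "monomial_value t 0 = 1"
  by (simp add: monomial_value_def)

lemma monomial_value_superset:
  "finite A \<Longrightarrow> Poly_Mapping.keys m \<subseteq> A \<Longrightarrow>
    monomial_value t m = (\<Prod>s\<in>A. t s ^ Poly_Mapping.lookup m s)"
  unfolding monomial_value_def by (rule prod.mono_neutral_left) (auto simp: in_keys_iff)

lemma monomial_value_add: "monomial_value t (m + m') = monomial_value t m * monomial_value t m'"
proof -
  let ?A = "Poly_Mapping.keys m \<union> Poly_Mapping.keys m'"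
  have "monomial_value t p = (\<Prod>s\<in>?A. t s ^ Poly_Mapping.lookup p s)"
    if "p \<in> {m, m', m + m'}" for p
    using that Poly_Mapping.keys_add[of m m'] by (intro monomial_value_superset) auto
  then show ?thesis
    by (simp add: prod.distrib lookup_add power_add)
qed

lemma monomial_value_single [simp]: "monomial_value t (Poly_Mapping.single s n) = t s ^ n"
  by (cases "n = 0") (simp_all add: monomial_value_def)

lemma poly_mapping_sum_singles:
  "p = (\<Sum>m\<in>Poly_Mapping.keys p. Poly_Mapping.single m (Poly_Mapping.lookup p m))"
  by (rule poly_mapping_eqI)
     (simp add: lookup_sum lookup_single when_def in_keys_iff)

text \<open>Serves on both levels of \<open>K_poly\<close>: for polynomials as sums of terms, and
  for monomials, whose exponents add up from those of single symbols.\<close>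

lemma poly_mapping_additive_induct [case_names single add]:
  fixes p :: "'k \<Rightarrow>\<^sub>0 'a::comm_monoid_add"
  assumes single: "\<And>k x. P (Poly_Mapping.single k x)"
    and add: "\<And>p p'. P p \<Longrightarrow> P p' \<Longrightarrow> P (p + p')"
  shows "P p"
proof -
  have "finite A \<Longrightarrow> P (\<Sum>m\<in>A. Poly_Mapping.single m (Poly_Mapping.lookup p m))" for A
  proof (induction A rule: finite_induct)
    case empty
    show ?case using single[of undefined 0] by simp
  qed (auto intro: add single)
  then show ?thesis
    by (subst poly_mapping_sum_singles) auto
qed

lemma single_eq_of_K: "Poly_Mapping.single m x = of_K x * Poly_Mapping.single m 1"
  by (simp add: of_K_def mult_single)

lemma single_monomial_value:
  "Poly_Mapping.single m (1 :: 'a :: comm_semiring_1) =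
    monomial_value (\<lambda>s. Poly_Mapping.single (Poly_Mapping.single s 1) 1) m"
proof (induction m rule: poly_mapping_additive_induct)
  case (single s n)
  have "Poly_Mapping.single (Poly_Mapping.single s n) (1 :: 'a) =
      Poly_Mapping.single (Poly_Mapping.single s 1) 1 ^ n"
  proof (induction n)
    case (Suc n)
    have "Poly_Mapping.single s (Suc n) = Poly_Mapping.single s 1 + Poly_Mapping.single s n"
      by (simp flip: single_add)
    then show ?case
      by (simp only: power_Suc mult_single mult_1 flip: Suc)
  qed simp
  then show ?case by simp
next
  case (add m m')
  show ?case
    unfolding monomial_value_add add[symmetric] by (simp add: mult_single)
qed

lemma of_K_0 [simp]: "of_K 0 = 0"
  and of_K_1 [simp]: "of_K 1 = 1"
  and of_K_add: "of_K (x + y) = of_K x + of_K y"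
  and of_K_diff: "of_K (x - y) = of_K x - of_K y"
  and of_K_mult: "of_K (x * y) = of_K x * of_K y"
  by (simp_all add: of_K_def single_add single_diff mult_single)

lemma of_K_of_nat: "of_K (of_nat n) = of_nat n"
  by (induction n) (simp_all add: of_K_add)


section \<open>The ideal of relations\<close>

lemma sigma_poly_single: "sigma_poly q (Poly_Mapping.single m x) = of_K (sigma_K q x) * monomial_value sigma_symb m"
  by (cases "x = 0") (simp_all add: sigma_poly_def monomial_value_def)

lemma sigma_poly_add: "q \<noteq> 0 \<Longrightarrow> sigma_poly q (p + p') = sigma_poly q p + sigma_poly q p'"
  unfolding sigma_poly_def
  by (rule setsum_keys_plus_distrib) (simp_all add: sigma_K_add of_K_add algebra_simps)

lemma sigma_poly_mult:
  assumes "q \<noteq> 0"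
  shows "sigma_poly q (p * p') = sigma_poly q p * sigma_poly q p'"
proof (induction p rule: poly_mapping_additive_induct)
  case (single m x)
  show ?case
    by (induction p' rule: poly_mapping_additive_induct)
      (use assms in \<open>simp_all add: mult_single sigma_poly_single sigma_K_mult of_K_mult
         monomial_value_add distrib_left sigma_poly_add\<close>)
qed (simp add: assms sigma_poly_add distrib_right)

lemma sigma_poly_of_K [simp]: "sigma_poly q (of_K x) = of_K (sigma_K q x)"
  by (simp add: of_K_def[of x] sigma_poly_single)

lemma sigma_poly_indet [simp]: "sigma_poly q (indet s) = sigma_symb s"
  by (simp add: indet_def sigma_poly_single)

lemma sigma_poly_0 [simp]: "sigma_poly q 0 = 0"
  and sigma_poly_1 [simp]: "sigma_poly q 1 = 1"
  using sigma_poly_of_K[of q 0] sigma_poly_of_K[of q 1] by simp_all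

lemma sigma_poly_uminus: "q \<noteq> 0 \<Longrightarrow> sigma_poly q (- p) = - sigma_poly q p"
  using sigma_poly_add[of q p "- p"] by (simp add: add_eq_0_iff)

lemma sigma_poly_diff: "q \<noteq> 0 \<Longrightarrow> sigma_poly q (p - p') = sigma_poly q p - sigma_poly q p'"
  using sigma_poly_add[of q p "- p'"] by (simp add: sigma_poly_uminus)

lemma sigma_poly_power: "q \<noteq> 0 \<Longrightarrow> sigma_poly q (p ^ n) = sigma_poly q p ^ n"
  by (induction n) (simp_all add: sigma_poly_mult)

lemma sigma_poly_e_symb: "c \<noteq> 0 \<Longrightarrow> sigma_poly q (e_symb c) = of_K (fls_const c) * e_symb c"
  by (simp add: e_symb_def Abs_complex_star_inverse)

text \<open>Ideals in terms of the type class operations, so that \<open>L_ideal q\<close> can be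
  handled by ordinary calculation in \<open>K_poly\<close>. Closure under negation is the case
  \<open>y = - 1\<close>.\<close>

definition type_ideal :: "'a::comm_ring_1 set \<Rightarrow> bool" where
  "type_ideal I \<longleftrightarrow> 0 \<in> I \<and> (\<forall>x\<in>I. \<forall>y\<in>I. x + y \<in> I) \<and> (\<forall>x\<in>I. \<forall>y. y * x \<in> I)"

lemma ideal_ring_of_type_algebra_iff:
  "ideal I (ring_of_type_algebra :: 'a::comm_ring_1 ring) \<longleftrightarrow> type_ideal I"
proof -
  interpret cring "ring_of_type_algebra :: 'a ring" by (rule cring_from_type_algebra)
  have inv: "a_inv (ring_of_type_algebra :: 'a ring) x = - x" for x
    by (rule minus_equality) (auto simp: ring_of_type_algebra_def)
  show ?thesis
  proof
    assume "ideal I (ring_of_type_algebra :: 'a ring)"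
    then interpret I: ideal I "ring_of_type_algebra :: 'a ring" .
    show "type_ideal I"
      using I.zero_closed I.a_closed I.I_l_closed
      by (auto simp: type_ideal_def ring_of_type_algebra_def)
  next
    assume I: "type_ideal I"
    show "ideal I (ring_of_type_algebra :: 'a ring)"
    proof (rule idealI[OF ring_axioms])
      show "subgroup I (add_monoid (ring_of_type_algebra :: 'a ring))"
      proof (rule add.subgroupI)
        show "\<ominus>\<^bsub>ring_of_type_algebra\<^esub> x \<in> I" if "x \<in> I" for x
          using I that unfolding inv type_ideal_def by (metis mult_minus1)
      qed (use I in \<open>auto simp: type_ideal_def ring_of_type_algebra_def\<close>)
    qed (use I in \<open>auto simp: type_ideal_def ring_of_type_algebra_def mult.commute\<close>)
  qed
qed

text \<open>The universal property of the generated ideal. \<open>L_ideal_minimal\<close> acts as an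
  induction principle: what holds for the relations and cuts out an ideal holds on all of
  \<open>L_ideal q\<close>.\<close>

lemma type_ideal_L_ideal: "type_ideal (L_ideal q)"
  and L_rels_subset: "L_rels q \<subseteq> L_ideal q"
  and L_ideal_minimal: "\<And>J. type_ideal J \<Longrightarrow> L_rels q \<subseteq> J \<Longrightarrow> L_ideal q \<subseteq> J"
proof -
  interpret cring K_poly_ring by (rule cring_from_type_algebra)
  have carrier: "L_rels q \<subseteq> carrier K_poly_ring"
    by (simp add: ring_of_type_algebra_def)
  show "type_ideal (L_ideal q)"
    unfolding L_ideal_def by (rule ideal_ring_of_type_algebra_iff[THEN iffD1], rule genideal_ideal[OF carrier])
  show "L_rels q \<subseteq> L_ideal q"
    unfolding L_ideal_def by (rule genideal_self[OF carrier])
  show "L_ideal q \<subseteq> J" if "type_ideal J" "L_rels q \<subseteq> J" for J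
    unfolding L_ideal_def by (rule genideal_minimal) (use that in \<open>auto simp: ideal_ring_of_type_algebra_iff\<close>)
qed

text \<open>Equality in L, expressed on representatives; cosets appear again only in the last
  section.\<close>

definition cong_L :: "complex \<Rightarrow> K_poly \<Rightarrow> K_poly \<Rightarrow> bool" where
  "cong_L q x y \<longleftrightarrow> x - y \<in> L_ideal q"

lemma
  assumes "type_ideal I"
  shows type_ideal_0: "0 \<in> I"
    and type_ideal_add: "x \<in> I \<Longrightarrow> y \<in> I \<Longrightarrow> x + y \<in> I"
    and type_ideal_mult: "x \<in> I \<Longrightarrow> z * x \<in> I"
  using assms by (auto simp: type_ideal_def)

lemmas L_ideal_0 = type_ideal_0[OF type_ideal_L_ideal]
  and L_ideal_add = type_ideal_add[OF type_ideal_L_ideal]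
  and L_ideal_mult = type_ideal_mult[OF type_ideal_L_ideal]

lemma cong_L_refl [simp]: "cong_L q x x"
  by (simp add: cong_L_def L_ideal_0)

lemma cong_L_sym: "cong_L q x y \<Longrightarrow> cong_L q y x"
  using L_ideal_mult[of "x - y" q "- 1"] by (simp add: cong_L_def)

lemma cong_L_trans [trans]: "cong_L q x y \<Longrightarrow> cong_L q y z \<Longrightarrow> cong_L q x z"
  using L_ideal_add[of "x - y" q "y - z"] by (simp add: cong_L_def)

lemma cong_L_add: "cong_L q x x' \<Longrightarrow> cong_L q y y' \<Longrightarrow> cong_L q (x + y) (x' + y')"
  using L_ideal_add[of "x - x'" q "y - y'"] by (simp add: cong_L_def algebra_simps)

lemma cong_L_mult_left: "cong_L q x y \<Longrightarrow> cong_L q (z * x) (z * y)"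
  using L_ideal_mult[of "x - y" q z] by (simp add: cong_L_def algebra_simps)

lemma cong_L_mult:
  assumes "cong_L q x x'" "cong_L q y y'"
  shows "cong_L q (x * y) (x' * y')"
proof -
  have "cong_L q (x * y) (x * y')"
    using assms(2) by (rule cong_L_mult_left)
  also have "cong_L q (x * y') (x' * y')"
    using cong_L_mult_left[OF assms(1), of y'] by (simp add: mult.commute)
  finally show ?thesis .
qed

lemma cong_L_diff: "cong_L q x x' \<Longrightarrow> cong_L q y y' \<Longrightarrow> cong_L q (x - y) (x' - y')"
  using cong_L_add[of q x x' "- 1 * y" "- 1 * y'"] cong_L_mult_left[of q y y' "- 1"] by simp

lemma cong_L_sum: "(\<And>i. i \<in> A \<Longrightarrow> cong_L q (f i) (g i)) \<Longrightarrow> cong_L q (sum f A) (sum g A)"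
  by (induction A rule: infinite_finite_induct) (auto intro: cong_L_add)

lemma cong_L_e_mult: "c \<noteq> 0 \<Longrightarrow> d \<noteq> 0 \<Longrightarrow> cong_L q (e_symb c * e_symb d) (e_symb (c * d))"
  and cong_L_e_1: "cong_L q (e_symb 1) 1"
  and cong_L_Theta: "cong_L q (indet Theta * indet ThetaInv) 1"
  unfolding cong_L_def by (rule L_rels_subset[THEN subsetD]; force simp: L_rels_def)+

lemma L_rels_cases [consumes 1, case_names e_mult e_1 e_q Theta]:
  assumes "r \<in> L_rels q"
  obtains c d where "c \<noteq> 0" "d \<noteq> 0" "r = e_symb c * e_symb d - e_symb (c * d)"
  | "r = e_symb 1 - 1" | "r = e_symb q - of_K fls_X"
  | "r = indet Theta * indet ThetaInv - 1"
  using assms unfolding L_rels_def by blast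

text \<open>Every relation is an eigenvector of \<open>sigma_poly q\<close>, with factor
  \<open>c * d\<close>, 1, \<open>q\<close> and 1 respectively. Hence the preimage of
  \<open>L_ideal q\<close> is an ideal that contains the relations.\<close>

lemma sigma_poly_L_ideal:
  assumes q: "q \<noteq> 0" and "p \<in> L_ideal q"
  shows "sigma_poly q p \<in> L_ideal q"
proof -
  have "L_ideal q \<subseteq> {p. sigma_poly q p \<in> L_ideal q}" (is "_ \<subseteq> ?J")
  proof (rule L_ideal_minimal)
    show "type_ideal ?J"
      using type_ideal_L_ideal[of q] q unfolding type_ideal_def
      by (auto simp: sigma_poly_add sigma_poly_mult)
    have "\<exists>y. sigma_poly q r = y * r" if "r \<in> L_rels q" for r
      using that
    proof (cases rule: L_rels_cases)
      case (e_mult c d)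
      then show ?thesis using q
        by (intro exI[of _ "of_K (fls_const (c * d))"])
          (simp add: sigma_poly_diff sigma_poly_mult sigma_poly_e_symb right_diff_distrib
            mult_ac flip: of_K_mult)
    next
      case e_1
      then show ?thesis using q
        by (intro exI[of _ 1]) (simp add: sigma_poly_diff sigma_poly_e_symb)
    next
      case e_q
      then show ?thesis using q
        by (intro exI[of _ "of_K (fls_const q)"])
          (simp add: sigma_poly_diff sigma_poly_e_symb sigma_K_X of_K_mult right_diff_distrib)
    next
      case Theta
      have "of_K fls_X * of_K (inverse fls_X) = 1"
        by (simp flip: of_K_mult)
      moreover have "of_K fls_X * indet Theta * (of_K (inverse fls_X) * indet ThetaInv) =
          of_K fls_X * of_K (inverse fls_X) * (indet Theta * indet ThetaInv)"
        by (simp only: mult_ac)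
      ultimately have "of_K fls_X * indet Theta * (of_K (inverse fls_X) * indet ThetaInv) =
          indet Theta * indet ThetaInv"
        by simp
      with Theta show ?thesis using q
        by (intro exI[of _ 1]) (simp add: sigma_poly_diff sigma_poly_mult)
    qed
    with L_rels_subset[of q] show "L_rels q \<subseteq> ?J"
      by (metis (mono_tags, lifting) L_ideal_mult mem_Collect_eq subsetD subsetI)
  qed
  with assms(2) show ?thesis by blast
qed

lemma sigma_poly_cong_L: "q \<noteq> 0 \<Longrightarrow> cong_L q x y \<Longrightarrow> cong_L q (sigma_poly q x) (sigma_poly q y)"
  using sigma_poly_L_ideal by (metis cong_L_def sigma_poly_diff)

text \<open>The functional below is the coefficient of the class of \<open>1\<close> in \<open>L\<close> after putting
  \<open>\<Theta> = l = 1\<close>. It kills the relations, so \<open>L\<close> is not the zero ring.\<close>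

fun symb_weight :: "symb \<Rightarrow> complex" where
  "symb_weight (E c) = Rep_complex_star c"
| "symb_weight _ = 1"

text \<open>In L the symbol of q^k becomes z^k. The weights of the other monomials lie in other
  classes of nonzero complex numbers modulo powers of \<open>q\<close>, and these get coefficient 0.
  The exponent is unique when |q| > 1.\<close>

definition weight_coeff :: "complex \<Rightarrow> complex \<Rightarrow> complex fls" where
  "weight_coeff q c = (if \<exists>k. c = q powi k then fls_X powi (THE k. c = q powi k) else 0)"

definition class_coeff :: "complex \<Rightarrow> K_poly \<Rightarrow> complex fls" where
  "class_coeff q p = (\<Sum>m\<in>Poly_Mapping.keys p.
     Poly_Mapping.lookup p m * weight_coeff q (monomial_value symb_weight m))"

lemma norm_gt_1_powi_inject:
  fixes q :: "'a::real_normed_field"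
  assumes "norm q > 1"
  shows "q powi k = q powi l \<longleftrightarrow> k = l"
proof
  assume "q powi k = q powi l"
  then have "norm q powi k = norm q powi l"
    by (metis norm_power_int)
  then show "k = l"
    using assms by (metis linorder_neq_iff power_int_strict_increasing less_irrefl)
qed simp

lemma weight_coeff_powi: "norm q > 1 \<Longrightarrow> weight_coeff q (q powi k) = fls_X powi k"
  by (auto simp: weight_coeff_def norm_gt_1_powi_inject)

lemma weight_coeff_mult_q:
  assumes q: "norm q > 1"
  shows "weight_coeff q (c * q) = fls_X * weight_coeff q c"
proof -
  have q0: "q \<noteq> 0" using q by auto
  show ?thesis
  proof (cases "\<exists>k. c = q powi k")
    case True
    then obtain k where k: "c = q powi k" ..
    then have "c * q = q powi (k + 1)"
      using q0 by (simp add: power_int_add)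
    with k q show ?thesis
      by (simp only: weight_coeff_powi) (simp add: power_int_add)
  next
    case False
    moreover have "c = q powi (k - 1)" if "c * q = q powi k" for k
      using that q0 by (simp add: power_int_diff field_simps)
    ultimately show ?thesis
      by (auto simp: weight_coeff_def)
  qed
qed

lemma class_coeff_single:
  "class_coeff q (Poly_Mapping.single m x) = x * weight_coeff q (monomial_value symb_weight m)"
  by (cases "x = 0") (simp_all add: class_coeff_def)

lemma class_coeff_add: "class_coeff q (p + p') = class_coeff q p + class_coeff q p'"
  unfolding class_coeff_def by (rule setsum_keys_plus_distrib) (simp_all add: algebra_simps)

lemma class_coeff_0 [simp]: "class_coeff q 0 = 0"
  by (simp add: class_coeff_def)

lemma class_coeff_diff: "class_coeff q (p - p') = class_coeff q p - class_coeff q p'"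
  using class_coeff_add[of q "p - p'" p'] by (simp add: algebra_simps)

text \<open>The kernel of \<open>class_coeff q\<close> is not an ideal, but the set of those
  \<open>r\<close> all of whose multiples lie in the kernel is one. It contains the relations
  because weights multiply, while 1 has coefficient 1.\<close>

lemma one_notin_L_ideal:
  assumes q: "norm q > 1"
  shows "1 \<notin> L_ideal q"
proof
  assume one: "1 \<in> L_ideal q"
  have "L_ideal q \<subseteq> {r. \<forall>p. class_coeff q (p * r) = 0}" (is "_ \<subseteq> ?J")
  proof (rule L_ideal_minimal)
    show "type_ideal ?J"
      by (auto simp: type_ideal_def distrib_left class_coeff_add simp flip: mult.assoc)
    show "L_rels q \<subseteq> ?J"
    proof
      fix r assume "r \<in> L_rels q"
      then have "class_coeff q (Poly_Mapping.single m x * r) = 0" for m x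
      proof (cases rule: L_rels_cases)
        case (e_mult c d)
        then show ?thesis
          by (simp add: right_diff_distrib class_coeff_diff e_symb_def indet_def mult_single
              class_coeff_single monomial_value_add Abs_complex_star_inverse)
      next
        case e_1
        then show ?thesis
          by (simp add: right_diff_distrib class_coeff_diff e_symb_def indet_def mult_single
              class_coeff_single monomial_value_add Abs_complex_star_inverse)
      next
        case e_q
        moreover have "q \<noteq> 0" using q by auto
        ultimately show ?thesis
          using q by (simp add: right_diff_distrib class_coeff_diff e_symb_def indet_def mult_single
              class_coeff_single monomial_value_add Abs_complex_star_inverse of_K_def
              weight_coeff_mult_q)
      next
        case Theta
        then show ?thesis
          by (simp add: right_diff_distrib class_coeff_diff indet_def mult_single
              class_coeff_single monomial_value_add)
      qed
      then have "class_coeff q (p * r) = 0" for p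
        by (induction p rule: poly_mapping_additive_induct) (simp_all add: distrib_right class_coeff_add)
      then show "r \<in> ?J" by simp
    qed
  qed
  with one have "class_coeff q (1 * 1) = 0" by blast
  moreover have "class_coeff q 1 = weight_coeff q (q powi 0)"
    using class_coeff_single[of q 0 1] by simp
  ultimately show False
    unfolding weight_coeff_powi[OF q] by simp
qed


section \<open>First-order equations in L\<close>

definition L_monomial :: "complex \<Rightarrow> nat \<Rightarrow> nat \<Rightarrow> K_poly" where
  "L_monomial c a b = e_symb c * indet Theta ^ a * indet ThetaInv ^ b"

text \<open>Polynomials congruent to such a product are closed under multiplication, since two
  symbols \<open>e_symb c\<close> and \<open>e_symb c'\<close> merge into one. A single
  \<open>e_symb\<close> therefore suffices for every monomial.\<close>

lemma single_cong_L_monomial: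
  "\<exists>c a b d. c \<noteq> 0 \<and> cong_L q (Poly_Mapping.single m 1) (L_monomial c a b * indet Ell ^ d)"
proof -
  define R where "R x \<longleftrightarrow> (\<exists>c a b d. c \<noteq> 0 \<and> cong_L q x (L_monomial c a b * indet Ell ^ d))" for x
  have R_mult: "R (x * x')" if "R x" "R x'" for x x'
  proof -
    from that obtain c a b d c' a' b' d' where c: "c \<noteq> 0" "c' \<noteq> 0"
      and x: "cong_L q x (L_monomial c a b * indet Ell ^ d)"
      and x': "cong_L q x' (L_monomial c' a' b' * indet Ell ^ d')"
      unfolding R_def by blast
    have "cong_L q (x * x') (L_monomial c a b * indet Ell ^ d * (L_monomial c' a' b' * indet Ell ^ d'))"
      using x x' by (rule cong_L_mult)
    also have "\<dots> = indet Theta ^ (a + a') * indet ThetaInv ^ (b + b') * indet Ell ^ (d + d') *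
        (e_symb c * e_symb c')"
      by (simp add: L_monomial_def power_add ac_simps)
    also have "cong_L q \<dots> (indet Theta ^ (a + a') * indet ThetaInv ^ (b + b') * indet Ell ^ (d + d') *
        e_symb (c * c'))"
      using c by (intro cong_L_mult_left cong_L_e_mult)
    also have "\<dots> = L_monomial (c * c') (a + a') (b + b') * indet Ell ^ (d + d')"
      by (simp add: L_monomial_def ac_simps)
    finally show ?thesis
      using c unfolding R_def by (metis mult_eq_0_iff)
  qed
  have R_I: "R x" if "c \<noteq> 0" "cong_L q x (L_monomial c a b * indet Ell ^ d)" for x c a b d
    using that unfolding R_def by blast
  have R_1: "R 1"
    using cong_L_sym[OF cong_L_e_1] by (intro R_I[of 1 _ 0 0 0]) (simp_all add: L_monomial_def)
  have R_indet: "R (indet s)" for s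
  proof (cases s)
    case (E c)
    have "Rep_complex_star c \<noteq> 0"
      using Rep_complex_star by simp
    then show ?thesis
      unfolding E by (intro R_I[of "Rep_complex_star c" _ 0 0 0])
        (simp_all add: L_monomial_def e_symb_def Rep_complex_star_inverse)
  next
    case Theta
    show ?thesis
      unfolding Theta using cong_L_mult[OF cong_L_sym[OF cong_L_e_1] cong_L_refl, of q "indet Theta"]
      by (intro R_I[of 1 _ 1 0 0]) (simp_all add: L_monomial_def)
  next
    case ThetaInv
    show ?thesis
      unfolding ThetaInv using cong_L_mult[OF cong_L_sym[OF cong_L_e_1] cong_L_refl, of q "indet ThetaInv"]
      by (intro R_I[of 1 _ 0 1 0]) (simp_all add: L_monomial_def)
  next
    case Ell
    show ?thesis
      unfolding Ell using cong_L_mult[OF cong_L_sym[OF cong_L_e_1] cong_L_refl, of q "indet Ell"]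
      by (intro R_I[of 1 _ 0 0 1]) (simp_all add: L_monomial_def)
  qed
  have R_power: "R (indet s ^ n)" for s n
    by (induction n) (simp_all add: R_1 R_mult R_indet)
  have "R (Poly_Mapping.single m 1)"
  proof (induction m rule: poly_mapping_additive_induct)
    case (single s n)
    have "Poly_Mapping.single (Poly_Mapping.single s n) 1 = indet s ^ n"
      by (subst single_monomial_value) (simp add: indet_def)
    with R_power show ?case by simp
  next
    case (add m m')
    then show ?case
      using R_mult[OF add] by (simp add: mult_single)
  qed
  then show ?thesis
    unfolding R_def .
qed

lemma sigma_poly_L_monomial:
  assumes "q \<noteq> 0" "c \<noteq> 0"
  shows "sigma_poly q (L_monomial c a b) = of_K (fls_const c * fls_X powi (int a - int b)) * L_monomial c a b"
proof -
  have "of_K (fls_X powi (int a - int b)) = of_K fls_X ^ a * of_K (inverse fls_X) ^ b"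
  proof -
    have "of_K x ^ n = of_K (x ^ n)" for x n
      by (induction n) (simp_all add: of_K_mult)
    then show ?thesis
      by (simp add: power_int_diff divide_inverse power_inverse flip: of_K_mult)
  qed
  then show ?thesis
    using assms by (simp add: L_monomial_def sigma_poly_mult sigma_poly_power sigma_poly_e_symb
        power_mult_distrib of_K_mult ac_simps)
qed

lemma sigma_Ell_power:
  "(indet Ell + 1) ^ d = indet Ell ^ d + (\<Sum>k<d. of_nat (d choose k) * indet Ell ^ k)"
proof -
  have "{..d} = insert d {..<d}" by auto
  then show ?thesis
    by (simp add: binomial_ring)
qed

text \<open>\<open>\<sigma> - 1\<close> on \<open>L\<close>: the logarithm \<open>l\<close> is needed only for the resonant part \<open>r\<close>, which
  \<open>\<sigma>\<close> fixes.\<close>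

lemma sigma_minus_1_surj_monomial:
  assumes q: "norm q > 1" and c: "c \<noteq> 0"
  shows "\<exists>g. cong_L q (sigma_poly q g - g) (of_K f * L_monomial c a b * indet Ell ^ d)"
\<comment> \<open>(l + 1)^d - l^d has degree below \<open>d\<close> in l, so every error term falls
  under the induction hypothesis; the coefficient \<open>f\<close> varies because these terms carry
  new ones.\<close>
proof (induction d arbitrary: f rule: less_induct)
  case (less d)
  have q0: "q \<noteq> 0" using q by auto
  define w where "w = L_monomial c a b"
  define Sol where "Sol p \<longleftrightarrow> (\<exists>g. cong_L q (sigma_poly q g - g) p)" for p
  have Sol_add: "Sol (p + p')" if "Sol p" "Sol p'" for p p'
    using that cong_L_add[of q _ p _ p'] q0 unfolding Sol_def
    by (metis add_diff_add sigma_poly_add)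
  have Sol_uminus: "Sol (- p)" if Sol: "Sol p" for p
  proof -
    obtain g where "cong_L q (sigma_poly q g - g) p"
      using Sol unfolding Sol_def by blast
    from cong_L_mult_left[OF this, of "- 1"] show ?thesis
      unfolding Sol_def by (intro exI[of _ "- g"]) (simp add: sigma_poly_uminus q0)
  qed
  have Sol_0: "Sol 0"
    unfolding Sol_def by (rule exI[of _ 0]) simp
  have Sol_sum: "Sol (\<Sum>k<d. of_nat (N k) * (of_K f * w * indet Ell ^ k))" for N f
  proof -
    have "Sol (\<Sum>k\<in>A. of_nat (N k) * (of_K f * w * indet Ell ^ k))" if "A \<subseteq> {..<d}" for A
      using finite_subset[OF that finite_lessThan] that
    proof (induction A rule: finite_induct)
      case (insert k A)
      have "Sol (of_K (of_nat (N k) * f) * w * indet Ell ^ k)"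
        using less.IH[of k] insert.prems unfolding Sol_def w_def by blast
      then have "Sol (of_nat (N k) * (of_K f * w * indet Ell ^ k))"
        by (simp add: of_K_mult of_K_of_nat mult.assoc)
      with insert show ?case
        by (simp add: Sol_add)
    qed (simp add: Sol_0)
    then show ?thesis by blast
  qed
  have Sol_image: "Sol (sigma_poly q g - g)" for g
    unfolding Sol_def by (rule exI[of _ g]) simp
  define k where "k = int a - int b"
  obtain h r where h: "fls_const c * fls_X powi k * sigma_K q h - h = f - r"
    and r: "fls_const c * fls_X powi k * sigma_K q r = r"
    using sigma_K_first_order_solvable[OF q c] by blast
  have sigma_w: "sigma_poly q (of_K x * w * indet Ell ^ n) =
      of_K (fls_const c * fls_X powi k * sigma_K q x) * w * (indet Ell + 1) ^ n" for x n
    using q0 c by (simp add: w_def k_def sigma_poly_mult sigma_poly_L_monomial sigma_poly_power of_K_mult ac_simps)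
  \<comment> \<open>\<sigma> - 1 sends \<open>g1\<close> to (f - r) w l^d plus terms of lower degree
    in l.\<close>
  define g1 where "g1 = of_K h * w * indet Ell ^ d"
  \<comment> \<open>\<sigma> fixes \<open>of_K r' * w\<close>, so \<sigma> - 1 acts on
    \<open>g2\<close> through l^(d+1) alone. The leading term of the result is (d + 1) r' w l^d, and
    the factor in \<open>r'\<close> cancels the d + 1.\<close>
  define r' where "r' = fls_const (1 / of_nat (Suc d)) * r"
  define g2 where "g2 = of_K r' * w * indet Ell ^ Suc d"
  have r': "fls_const c * fls_X powi k * sigma_K q r' = r'"
  proof -
    have "fls_const c * fls_X powi k * sigma_K q r' =
        fls_const (1 / of_nat (Suc d)) * (fls_const c * fls_X powi k * sigma_K q r)"
      unfolding r'_def sigma_K_mult[OF q0] sigma_K_const by (simp only: mult_ac)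
    then show ?thesis
      unfolding r r'_def .
  qed
  have "of_nat (Suc d) * r' = r"
    unfolding r'_def by (simp only: fls_of_nat mult.assoc[symmetric] fls_const_mult_const) (use of_nat_neq_0[of d, where 'a = complex] in simp)
  then have Suc_d_r': "of_nat (Suc d) * of_K r' = of_K r"
    by (metis of_K_mult of_K_of_nat)
  have h': "fls_const c * fls_X powi k * sigma_K q h = h + f - r"
    using h by (simp add: algebra_simps)
  have 1: "sigma_poly q g1 - g1 = of_K f * w * indet Ell ^ d - of_K r * w * indet Ell ^ d +
      (\<Sum>k<d. of_nat (d choose k) * (of_K (h + f - r) * w * indet Ell ^ k))"
    unfolding g1_def sigma_w h' sigma_Ell_power
    by (simp add: of_K_add of_K_diff algebra_simps sum_distrib_left sum.distrib sum_subtractf)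
  have "sigma_poly q g2 - g2 = of_K r' * w * (\<Sum>k<Suc d. of_nat (Suc d choose k) * indet Ell ^ k)"
    unfolding g2_def sigma_w r' sigma_Ell_power by (simp only: distrib_left add_diff_cancel_left')
  also have "\<dots> = of_nat (Suc d) * of_K r' * w * indet Ell ^ d +
      (\<Sum>k<d. of_nat (Suc d choose k) * (of_K r' * w * indet Ell ^ k))"
    by (simp add: distrib_left distrib_right sum_distrib_left mult_ac del: of_nat_Suc binomial_Suc_Suc)
  finally have 2: "of_K r * w * indet Ell ^ d = sigma_poly q g2 - g2 -
      (\<Sum>k<d. of_nat (Suc d choose k) * (of_K r' * w * indet Ell ^ k))"
    unfolding Suc_d_r' by simp
  have rearrange: "F = A + - S + (B + - S')" if "A = F - R + S" "R = B - S'" for A B F R S S' :: K_poly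
    using that by simp
  have "of_K f * w * indet Ell ^ d = (sigma_poly q g1 - g1) +
      - (\<Sum>k<d. of_nat (d choose k) * (of_K (h + f - r) * w * indet Ell ^ k)) +
      ((sigma_poly q g2 - g2) + - (\<Sum>k<d. of_nat (Suc d choose k) * (of_K r' * w * indet Ell ^ k)))"
    by (rule rearrange[OF 1 2])
  then have "Sol (of_K f * w * indet Ell ^ d)"
    by (simp only:) (intro Sol_add Sol_uminus Sol_sum Sol_image)
  then show ?case
    unfolding Sol_def w_def .
qed

lemma sigma_minus_1_surj:
  assumes q: "norm q > 1"
  shows "\<exists>g. cong_L q (sigma_poly q g - g) p"
proof (induction p rule: poly_mapping_additive_induct)
  case (single m x)
  obtain c a b d where c: "c \<noteq> 0"
    and m: "cong_L q (Poly_Mapping.single m 1) (L_monomial c a b * indet Ell ^ d)"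
    using single_cong_L_monomial by blast
  obtain g where "cong_L q (sigma_poly q g - g) (of_K x * L_monomial c a b * indet Ell ^ d)"
    using sigma_minus_1_surj_monomial[OF q c] by blast
  also have "cong_L q \<dots> (of_K x * Poly_Mapping.single m 1)"
    using cong_L_mult_left[OF cong_L_sym[OF m]] by (simp add: mult.assoc)
  also have "\<dots> = Poly_Mapping.single m x"
    by (rule single_eq_of_K[symmetric])
  finally show ?case ..
next
  case (add p p')
  then obtain g g' where "cong_L q (sigma_poly q g - g) p" "cong_L q (sigma_poly q g' - g') p'"
    by blast
  moreover have "q \<noteq> 0" using q by auto
  ultimately have "cong_L q (sigma_poly q (g + g') - (g + g')) (p + p')"
    using cong_L_add by (simp add: sigma_poly_add add_diff_add)
  then show ?case ..
qed

text \<open>Variation of constants: (\<sigma> - u)(y g) = u y (\<sigma> - 1) g, and u y is a unit.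
  It remains to solve for g after dividing the right-hand side by u y.\<close>

lemma first_order_surj:
  assumes q: "norm q > 1" and u: "u \<noteq> 0"
    and y: "sigma_poly q y = of_K u * y" "cong_L q (y * y') 1"
  shows "\<exists>g. cong_L q (sigma_poly q g - of_K u * g) p"
proof -
  have q0: "q \<noteq> 0" using q by auto
  obtain g where g: "cong_L q (sigma_poly q g - g) (of_K (inverse u) * y' * p)"
    using sigma_minus_1_surj[OF q] by blast
  have "sigma_poly q (y * g) - of_K u * (y * g) = of_K u * y * (sigma_poly q g - g)"
    using q0 by (simp add: sigma_poly_mult y right_diff_distrib mult.assoc)
  also have "cong_L q \<dots> (of_K u * y * (of_K (inverse u) * y' * p))"
    using g by (rule cong_L_mult_left)
  also have "\<dots> = of_K (u * inverse u) * (y * y' * p)"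
    by (simp add: of_K_mult mult_ac)
  also have "\<dots> = y * y' * p"
    using u by simp
  also have "cong_L q \<dots> (1 * p)"
    using y(2) by (intro cong_L_mult cong_L_refl)
  finally show ?thesis by auto
qed


section \<open>Newton polygon and Frobenius method\<close>

lemma sigma_K_compose: "q \<noteq> 0 \<Longrightarrow> q' \<noteq> 0 \<Longrightarrow> sigma_K q (sigma_K q' f) = sigma_K (q * q') f"
  by (intro fls_eqI) (simp add: sigma_K_nth power_int_mult_distrib)

lemma sigma_K_X_powi: "q \<noteq> 0 \<Longrightarrow> sigma_K q (fls_X powi k) = fls_const (q powi k) * fls_X powi k"
  by (simp add: sigma_K_def fls_compose_fps_powi fls_times_fps_to_fls power_int_mult_distrib fls_const_power_int)

text \<open>The abscissae at which a line of slope \<open>\<mu>\<close> touches the Newton polygon.\<close>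

definition newton_contacts :: "nat \<Rightarrow> (nat \<Rightarrow> complex fls) \<Rightarrow> real \<Rightarrow> nat set" where
  "newton_contacts n a \<mu> = {i. i \<le> n \<and> a i \<noteq> 0 \<and> (\<forall>j\<le>n. a j \<noteq> 0 \<longrightarrow>
     real_of_int (fls_subdegree (a i)) - \<mu> * i \<le> real_of_int (fls_subdegree (a j)) - \<mu> * j)}"

text \<open>Integrality of slopes in terms of valuations of coefficients. The induction passes this
  form to the quotient by comparing valuations, without returning to convex hulls.\<close>

definition integral_slopes :: "nat \<Rightarrow> (nat \<Rightarrow> complex fls) \<Rightarrow> bool" where
  "integral_slopes n a \<longleftrightarrow>
     (\<forall>\<mu>. \<forall>i\<in>newton_contacts n a \<mu>. \<forall>j\<in>newton_contacts n a \<mu>. i \<noteq> j \<longrightarrow> \<mu> \<in> \<int>)"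

text \<open>A line that touches the polygon from below is a supporting line and cuts out a face. Two
  different contacts make this face one-dimensional.\<close>

lemma newton_contacts_slope:
  assumes i: "i \<in> newton_contacts n a \<mu>" and j: "j \<in> newton_contacts n a \<mu>" and "i \<noteq> j"
  shows "\<mu> \<in> slopes n a"
proof -
  define v where "v i = real_of_int (fls_subdegree (a i))" for i
  define m where "m = v i - \<mu> * i"
  define N where "N = newton_polygon n a"
  \<comment> \<open>The inner product of (-\<mu>, 1) with (x, y) is y - \<mu> x, the intercept of
    the line of slope \<mu> through that point.\<close>
  define H :: "(real \<times> real) set" where "H = {p. (- \<mu>, 1) \<bullet> p = m}"
  have v_j: "v j - \<mu> * j = m"
    using i j unfolding newton_contacts_def m_def v_def by (auto intro!: antisym)
  have below: "v k - \<mu> * k \<ge> m" if "k \<le> n" "a k \<noteq> 0" for k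
    using i that unfolding newton_contacts_def m_def v_def by auto
  have "N \<subseteq> {p. (- \<mu>, 1) \<bullet> p \<ge> m}"
    unfolding N_def newton_polygon_def
  proof (rule hull_minimal)
    show "{(real i, real_of_int j) |i j. i \<le> n \<and> a i \<noteq> 0 \<and> fls_subdegree (a i) \<le> j}
        \<subseteq> {p. (- \<mu>, 1) \<bullet> p \<ge> m}"
    proof clarsimp
      fix k l assume "k \<le> n" "a k \<noteq> 0" "fls_subdegree (a k) \<le> l"
      then show "m \<le> real_of_int l - \<mu> * k"
        using below[of k] by (simp add: v_def)
    qed
  qed (simp add: convex_halfspace_ge)
  moreover have "convex N"
    by (simp add: N_def newton_polygon_def)
  ultimately have face: "(N \<inter> H) face_of N"
    unfolding H_def by (intro face_of_Int_supporting_hyperplane_ge) auto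
  have mem: "(real k, v k) \<in> N \<inter> H" if "k \<in> {i, j}" for k
  proof
    show "(real k, v k) \<in> N"
      unfolding N_def newton_polygon_def v_def
      by (rule hull_inc) (use that i j in \<open>auto simp: newton_contacts_def\<close>)
    show "(real k, v k) \<in> H"
      using that v_j by (auto simp: H_def m_def)
  qed
  have "aff_dim (N \<inter> H) = 1"
  proof (rule antisym)
    have "aff_dim (N \<inter> H) \<le> aff_dim H"
      by (rule aff_dim_subset) simp
    also have "aff_dim H = 1"
      unfolding H_def by (subst aff_dim_hyperplane) (auto simp: zero_prod_def)
    finally show "aff_dim (N \<inter> H) \<le> 1" .
    have "1 = aff_dim {(real i, v i), (real j, v j)}"
      using \<open>i \<noteq> j\<close> by (simp add: aff_dim_2)
    also have "\<dots> \<le> aff_dim (N \<inter> H)"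
      using mem by (intro aff_dim_subset) auto
    finally show "1 \<le> aff_dim (N \<inter> H)" .
  qed
  with face have "(N \<inter> H) edge_of newton_polygon n a"
    by (simp add: edge_of_def N_def)
  moreover have "\<mu> = (v j - v i) / (real j - real i)"
    using v_j \<open>i \<noteq> j\<close> unfolding m_def by (simp add: field_simps)
  ultimately show ?thesis
    using mem \<open>i \<noteq> j\<close> unfolding slopes_def by (auto intro!: exI[of _ "N \<inter> H"] exI)
qed

text \<open>Among the chords that start at the lowest point over 0, one of least slope has the whole
  polygon on or above it: it spans the leftmost edge.\<close>

lemma newton_contacts_exist:
  assumes "a 0 \<noteq> 0" "a n \<noteq> 0" "n > 0"
  obtains \<mu> i where "0 \<in> newton_contacts n a \<mu>" "i \<in> newton_contacts n a \<mu>" "i \<noteq> 0"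
proof -
  define s where "s i = (real_of_int (fls_subdegree (a i)) - real_of_int (fls_subdegree (a 0))) / real i" for i
  define A where "A = {i. 0 < i \<and> i \<le> n \<and> a i \<noteq> 0}"
  have fin: "finite (s ` A)" and "s ` A \<noteq> {}"
    using assms by (auto simp: A_def)
  then have "Min (s ` A) \<in> s ` A"
    by (rule Min_in)
  then obtain i where i: "i \<in> A" and min: "s i = Min (s ` A)"
    by auto
  have le: "s i \<le> s j" if "j \<in> A" for j
    using that fin by (simp add: min)
  have above: "fls_subdegree (a 0) \<le> fls_subdegree (a j) - s i * j" if "j \<le> n" "a j \<noteq> 0" for j
  proof (cases "j = 0")
    case False
    with that le[of j] have "s i * j \<le> s j * j"
      by (auto simp: A_def intro!: mult_right_mono)
    also have "s j * j = fls_subdegree (a j) - fls_subdegree (a 0)"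
      using False by (simp add: s_def)
    finally show ?thesis by simp
  qed simp
  have "fls_subdegree (a 0) = fls_subdegree (a i) - s i * i"
    using i by (simp add: A_def s_def)
  then show ?thesis
    using i above assms by (intro that[of "s i" i]) (auto simp: A_def newton_contacts_def)
qed

text \<open>\<open>c\<close> is a nonzero root of largest modulus, and multiplication by
  \<open>q\<close> increases the modulus. Nonzero roots exist because two nonzero coefficients
  prevent \<open>p\<close> from being a monomial.\<close>

lemma exists_extremal_root:
  fixes p :: "complex poly"
  assumes q: "norm q > 1" and coeffs: "coeff p i \<noteq> 0" "coeff p j \<noteq> 0" "i \<noteq> j"
  obtains c where "c \<noteq> 0" "poly p c = 0" "\<And>k. k > 0 \<Longrightarrow> poly p (c * q ^ k) \<noteq> 0"
proof -
  have p: "p \<noteq> 0" using coeffs by auto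
  define Z where "Z = {x. poly p x = 0 \<and> x \<noteq> 0}"
  have fin: "finite Z"
    unfolding Z_def using poly_roots_finite[OF p] by (rule finite_subset[rotated]) auto
  define k where "k = order 0 p"
  obtain r where r: "p = [:0, 1:] ^ k * r" "\<not> [:0, 1:] dvd r"
    using order_decomp[OF p, of 0] unfolding k_def by auto
  have "\<not> constant (poly r)"
  proof
    assume "constant (poly r)"
    then have "degree r = 0"
      by (simp add: constant_degree)
    then obtain b where "r = [:b:]"
      by (rule degree_eq_zeroE)
    then have "p = monom b k"
      by (simp add: r(1) monom_altdef)
    with coeffs show False
      by (metis coeff_monom)
  qed
  then obtain x where "poly r x = 0"
    using fundamental_theorem_of_algebra by blast
  moreover have "x \<noteq> 0"
    using r(2) calculation poly_eq_0_iff_dvd[of r 0] by auto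
  ultimately have "x \<in> Z"
    unfolding Z_def by (subst r(1)) simp
  then have "Max (norm ` Z) \<in> norm ` Z"
    using fin by (intro Max_in) auto
  then obtain c where c: "c \<in> Z" "norm c = Max (norm ` Z)"
    by auto
  have "poly p (c * q ^ k) \<noteq> 0" if "k > 0" for k
  proof
    assume "poly p (c * q ^ k) = 0"
    moreover have "c \<noteq> 0" "q \<noteq> 0"
      using c q by (auto simp: Z_def)
    ultimately have "c * q ^ k \<in> Z"
      by (simp add: Z_def)
    then have "norm (c * q ^ k) \<le> norm c"
      using fin c by simp
    moreover have "norm q ^ k > 1"
      using q that by (simp add: one_less_power)
    ultimately show False
      using \<open>c \<noteq> 0\<close> by (simp add: norm_mult norm_power)
  qed
  with c show ?thesis
    by (intro that[of c]) (auto simp: Z_def)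
qed

text \<open>The last factor in the sum is the i-th iterate of \<sigma> on \<open>H\<close>. The
  coefficient at N is the sum over k \<le> N of ch (N-k) (c q^k) H(k), whose last term has the
  factor p(c q^N). This factor vanishes for N = 0, so that H(0) = 1 is allowed, and for no N > 0, so
  that H(N) is determined.\<close>

lemma fps_frobenius_solution:
  fixes B :: "nat \<Rightarrow> complex fps"
  assumes q: "norm q > 1"
    and B: "i0 \<le> n" "fps_nth (B i0) 0 \<noteq> 0" "j0 \<le> n" "fps_nth (B j0) 0 \<noteq> 0" "i0 \<noteq> j0"
  obtains c H where "c \<noteq> 0" "fps_nth H 0 = 1"
    "(\<Sum>i\<le>n. fps_const (c ^ i) * B i * Abs_fps (\<lambda>m. fps_nth H m * (q ^ i) ^ m)) = 0"
proof -
  define p where "p = (\<Sum>i\<le>n. monom (fps_nth (B i) 0) i)"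
  have coeff_p: "coeff p i = fps_nth (B i) 0" if "i \<le> n" for i
    using that by (simp add: p_def coeff_sum)
  obtain c where c: "c \<noteq> 0" "poly p c = 0" "\<And>k. k > 0 \<Longrightarrow> poly p (c * q ^ k) \<noteq> 0"
    using exists_extremal_root[OF q, of p i0 j0] B coeff_p by auto
  have poly_p: "poly p x = (\<Sum>i\<le>n. fps_nth (B i) 0 * x ^ i)" for x
    by (simp add: p_def poly_sum poly_monom)
  define ch where "ch N x = (\<Sum>i\<le>n. fps_nth (B i) N * x ^ i)" for N x
  obtain h :: "complex fls" where h: "fls_nth h N = (if N < 0 then 0 else if N = 0 then 1 else
      - (\<Sum>k<nat N. ch (nat N - k) (c * q ^ k) * fls_nth h (int k)) / poly p (c * q ^ nat N))" for N
    by (rule fls_recursion[of "\<lambda>N h. if N < 0 then 0 else if N = 0 then 1 else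
      - (\<Sum>k<nat N. ch (nat N - k) (c * q ^ k) * h (int k)) / poly p (c * q ^ nat N)" 0])
      (auto intro!: sum.cong)
  define H where "H = fls_regpart h"
  have H0: "fps_nth H 0 = 1"
    by (simp add: H_def h)
  have H: "(\<Sum>k<N. ch (N - k) (c * q ^ k) * fps_nth H k) + poly p (c * q ^ N) * fps_nth H N = 0" for N
  proof (cases "N = 0")
    case True
    then show ?thesis using c by simp
  next
    case False
    then have "fps_nth H N = - (\<Sum>k<N. ch (N - k) (c * q ^ k) * fps_nth H k) / poly p (c * q ^ N)"
      unfolding H_def fls_regpart_nth by (subst h) simp
    with c(3)[of N] False show ?thesis
      by (simp add: divide_simps mult.commute)
  qed
  have "(\<Sum>i\<le>n. Abs_fps (\<lambda>m. fps_nth H m * (q ^ i) ^ m) * (fps_const (c ^ i) * B i)) = 0" (is "?S = 0")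
  proof (rule fps_ext)
    fix N
    have "fps_nth ?S N = (\<Sum>i\<le>n. \<Sum>k=0..N. fps_nth H k * (q ^ i) ^ k * (c ^ i * fps_nth (B i) (N - k)))"
      by (simp add: fps_sum_nth fps_mult_nth[of "Abs_fps _"])
    also have "\<dots> = (\<Sum>k=0..N. ch (N - k) (c * q ^ k) * fps_nth H k)"
      by (subst sum.swap) (simp add: ch_def sum_distrib_left sum_distrib_right power_mult_distrib mult_ac
        flip: power_mult)
    also have "\<dots> = (\<Sum>k<N. ch (N - k) (c * q ^ k) * fps_nth H k) + ch 0 (c * q ^ N) * fps_nth H N"
      by (simp add: atLeast0AtMost lessThan_Suc_atMost[symmetric])
    also have "\<dots> = 0"
      using H[of N] by (simp add: ch_def poly_p)
    finally show "fps_nth ?S N = fps_nth 0 N" by simp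
  qed
  then show ?thesis
    using c H0 by (intro that[of c H]) (simp_all add: mult_ac)
qed


section \<open>Splitting off a first-order factor\<close>

text \<open>If \<sigma> y = u y, then \<sigma>^i y = \<open>sigma_prod q u i\<close> y. Thus P y = 0
  becomes a condition on \<open>u\<close> inside K.\<close>

definition sigma_prod :: "complex \<Rightarrow> complex fls \<Rightarrow> nat \<Rightarrow> complex fls" where
  "sigma_prod q u i = (\<Prod>l<i. sigma_K (q ^ l) u)"

lemma sigma_prod_0 [simp]: "sigma_prod q u 0 = 1"
  and sigma_prod_Suc: "sigma_prod q u (Suc i) = sigma_prod q u i * sigma_K (q ^ i) u"
  by (simp_all add: sigma_prod_def)

lemma sigma_K_by_1: "sigma_K 1 f = f"
  by (intro fls_eqI) (simp add: sigma_K_nth)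

text \<open>Passing from a solution y of \<sigma> y = w y to g y multiplies w by \<sigma>(g)/g, and
  the product of these quotients telescopes.\<close>

lemma sigma_prod_gauge:
  assumes q: "q \<noteq> 0" and g: "g \<noteq> 0"
  shows "sigma_prod q (w * sigma_K q g / g) i * g = sigma_prod q w i * sigma_K (q ^ i) g"
proof (induction i)
  case 0
  show ?case by (simp add: sigma_K_by_1)
next
  case (Suc i)
  have nz: "sigma_K (q ^ i) g \<noteq> 0"
    using q g by (simp add: sigma_K_eq_0_iff)
  have "sigma_K (q ^ i) (w * sigma_K q g / g) =
      sigma_K (q ^ i) w * sigma_K (q ^ Suc i) g / sigma_K (q ^ i) g"
    using q by (simp add: divide_inverse sigma_K_mult sigma_K_inverse sigma_K_compose mult.commute[of q])
  then have "sigma_prod q (w * sigma_K q g / g) (Suc i) * g =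
      (sigma_prod q (w * sigma_K q g / g) i * g) * (sigma_K (q ^ i) w * sigma_K (q ^ Suc i) g / sigma_K (q ^ i) g)"
    by (simp add: sigma_prod_Suc)
  also have "\<dots> = sigma_prod q w (Suc i) * sigma_K (q ^ Suc i) g"
    unfolding Suc.IH using nz by (simp add: sigma_prod_Suc)
  finally show ?case .
qed

text \<open>\<open>T i\<close> equals q^(k i (i-1)/2). It is obtained before \<open>c\<close>
  because \<open>c\<close> is later chosen as a root of a polynomial whose coefficients contain the
  \<open>T i\<close>.\<close>

lemma sigma_prod_monomial:
  assumes q: "q \<noteq> 0"
  obtains T where "\<And>i. T i \<noteq> 0"
    "\<And>c i. sigma_prod q (fls_const c * fls_X powi k) i = fls_const (c ^ i * T i) * fls_X powi (k * int i)"
proof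
  define T where "T i = (\<Prod>l<i. (q ^ l) powi k)" for i
  show "T i \<noteq> 0" for i
    using q by (simp add: T_def)
  show "sigma_prod q (fls_const c * fls_X powi k) i = fls_const (c ^ i * T i) * fls_X powi (k * int i)" for c i
  proof (induction i)
    case (Suc i)
    have "fls_X powi (k * int (Suc i)) = (fls_X powi (k * int i) * fls_X powi k :: complex fls)"
      by (simp add: distrib_left power_int_add)
    moreover have "fls_const (c ^ Suc i * T (Suc i)) = fls_const (c ^ i * T i) * (fls_const c * fls_const ((q ^ i) powi k))"
      by (simp add: T_def mult_ac)
    ultimately show ?case
      using q unfolding sigma_prod_Suc Suc.IH by (simp only: sigma_K_mult sigma_K_X_powi sigma_K_const
        power_not_zero not_False_eq_True mult_ac)
  qed (simp add: T_def)
qed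

lemma fps_to_fls_sum: "fps_to_fls (sum f A) = (\<Sum>i\<in>A. fps_to_fls (f i))"
  by (induction A rule: infinite_finite_induct) simp_all

text \<open>The power z^(-\<mu>) in \<open>u\<close> tilts the line of slope \<mu> to a horizontal
  one: the a(i) z^(-\<mu> i) all have valuation at least \<open>m\<close>, with equality at the
  contacts. Dividing by z^m leaves the power series problem solved above.\<close>

lemma first_order_right_factor:
  assumes q: "norm q > 1"
    and contacts: "i0 \<in> newton_contacts n a (of_int \<mu>)" "j0 \<in> newton_contacts n a (of_int \<mu>)" "i0 \<noteq> j0"
  obtains c g where "c \<noteq> 0" "g \<noteq> 0"
    "(\<Sum>i\<le>n. a i * sigma_prod q (fls_const c * fls_X powi (- \<mu>) * sigma_K q g / g) i) = 0"
proof -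
  have q0: "q \<noteq> 0" using q by auto
  obtain T where T: "\<And>i. T i \<noteq> 0"
    "\<And>c i. sigma_prod q (fls_const c * fls_X powi (- \<mu>)) i = fls_const (c ^ i * T i) * fls_X powi (- \<mu> * int i)"
    using sigma_prod_monomial[OF q0] by blast
  define m where "m = fls_subdegree (a i0) - \<mu> * int i0"
  have m_le: "m \<le> fls_subdegree (a i) - \<mu> * int i" if "i \<le> n" "a i \<noteq> 0" for i
  proof -
    have "real_of_int m \<le> real_of_int (fls_subdegree (a i) - \<mu> * int i)"
      using contacts(1) that by (simp add: newton_contacts_def m_def)
    then show ?thesis by linarith
  qed
  have m_eq: "fls_subdegree (a j0) - \<mu> * int j0 = m"
  proof -
    have "real_of_int (fls_subdegree (a j0) - \<mu> * int j0) \<le> real_of_int m"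
      using contacts by (simp add: newton_contacts_def m_def)
    then have "fls_subdegree (a j0) - \<mu> * int j0 \<le> m" by linarith
    with m_le[of j0] contacts show ?thesis
      by (simp add: newton_contacts_def)
  qed
  \<comment> \<open>\<open>B i\<close> is T(i) a(i) z^(-\<mu> i - m), so contacts become nonzero
    constant terms.\<close>
  define B where "B i = Abs_fps (\<lambda>N. T i * fls_nth (a i) (int N + m + \<mu> * int i))" for i
  have "fps_nth (B i) 0 \<noteq> 0" if "i \<in> {i0, j0}" for i
  proof -
    have "m + \<mu> * int i = fls_subdegree (a i)" "a i \<noteq> 0"
      using that m_eq contacts by (auto simp: m_def newton_contacts_def)
    then show ?thesis
      using T(1) by (simp add: B_def nth_fls_subdegree_nonzero)
  qed
  moreover have "i0 \<le> n" "j0 \<le> n"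
    using contacts by (auto simp: newton_contacts_def)
  ultimately obtain c H where c: "c \<noteq> 0" and H: "fps_nth H 0 = 1"
    "(\<Sum>i\<le>n. fps_const (c ^ i) * B i * Abs_fps (\<lambda>m. fps_nth H m * (q ^ i) ^ m)) = 0"
    using fps_frobenius_solution[OF q, of i0 n B j0] contacts(3) by blast
  define g where "g = fps_to_fls H"
  have g: "g \<noteq> 0"
    using H(1) unfolding g_def by (metis fps_to_fls_eq_0_iff fps_zero_nth zero_neq_one)
  have sigma_g: "sigma_K (q ^ i) g = fps_to_fls (Abs_fps (\<lambda>m. fps_nth H m * (q ^ i) ^ m))" for i
    using q0 by (intro fls_eqI) (simp add: sigma_K_nth g_def power_int_def)
  have a_B: "a i * fls_const (T i) * fls_X powi (- \<mu> * int i) = fls_X powi m * fps_to_fls (B i)" if "i \<le> n" for i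
  proof (rule fls_eqI)
    fix N
    have "fls_nth (a i) (N + \<mu> * int i) = 0" if "N < m"
      using m_le[of i] \<open>i \<le> n\<close> that by (cases "a i = 0") auto
    moreover have reorder: "a i * fls_const (T i) * fls_X powi k = fls_X powi k * (fls_const (T i) * a i)" for k
      by (simp only: mult_ac)
    have "fls_nth (a i * fls_const (T i) * fls_X powi (- \<mu> * int i)) N = T i * fls_nth (a i) (N + \<mu> * int i)"
      unfolding reorder fls_X_powi_mult_nth by simp
    ultimately show "fls_nth (a i * fls_const (T i) * fls_X powi (- \<mu> * int i)) N =
        fls_nth (fls_X powi m * fps_to_fls (B i)) N"
      by (auto simp: fls_X_powi_mult_nth B_def)
  qed
  define w where "w = fls_const c * fls_X powi (- \<mu>)"
  have "(\<Sum>i\<le>n. a i * sigma_prod q (w * sigma_K q g / g) i) * g = (\<Sum>i\<le>n. a i * (sigma_prod q w i * sigma_K (q ^ i) g))"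
    using sigma_prod_gauge[OF q0 g, of w] by (simp add: sum_distrib_right mult.assoc)
  also have "\<dots> = (\<Sum>i\<le>n. a i * fls_const (T i) * fls_X powi (- \<mu> * int i) * (fls_const (c ^ i) * sigma_K (q ^ i) g))"
    unfolding w_def T by (simp only: fls_const_mult_const[symmetric] mult_ac)
  also have "\<dots> = (\<Sum>i\<le>n. fls_X powi m * fps_to_fls (fps_const (c ^ i) * B i * Abs_fps (\<lambda>m. fps_nth H m * (q ^ i) ^ m)))"
    by (rule sum.cong[OF refl], simp only: a_B atMost_iff) (simp add: sigma_g fls_times_fps_to_fls mult_ac)
  also have "\<dots> = fls_X powi m * fps_to_fls 0"
    unfolding sum_distrib_left[symmetric] fps_to_fls_sum[symmetric] H(2) ..
  finally have "(\<Sum>i\<le>n. a i * sigma_prod q (w * sigma_K q g / g) i) = 0"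
    using g by simp
  then show ?thesis
    using that[OF c g] by (simp add: w_def)
qed

text \<open>Coefficients b of Q in P = Q (\<sigma> - u). With U(i) =
  \<open>sigma_prod q u i\<close>, comparing coefficients gives a(i) U(i) = b(i-1) U(i) - b(i)
  U(i+1). This telescopes, so b(j) U(j+1) is a tail sum of the a(i) U(i).\<close>

definition right_quotient :: "complex \<Rightarrow> nat \<Rightarrow> (nat \<Rightarrow> complex fls) \<Rightarrow> complex fls \<Rightarrow> nat \<Rightarrow> complex fls" where
  "right_quotient q n a u j = (\<Sum>i\<in>{j<..n}. a i * sigma_prod q u i) / sigma_prod q u (Suc j)"

lemma right_quotient_ge: "n \<le> j \<Longrightarrow> right_quotient q n a u j = 0"
  by (simp add: right_quotient_def)

lemma right_quotient:
  assumes q: "q \<noteq> 0" and u: "u \<noteq> 0" and root: "(\<Sum>i\<le>n. a i * sigma_prod q u i) = 0" and i: "i \<le> n"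
  shows "a i = (if i = 0 then 0 else right_quotient q n a u (i - 1)) - right_quotient q n a u i * sigma_K (q ^ i) u"
proof -
  define U where "U = sigma_prod q u"
  have U: "U i \<noteq> 0" "U (Suc i) = U i * sigma_K (q ^ i) u" for i
    using q u by (auto simp: U_def sigma_prod_def sigma_K_eq_0_iff)
  have "{i<..n} \<union> {i} = {i..n}"
    using i by auto
  then have "(\<Sum>k\<in>{i..n}. a k * U k) = a i * U i + (\<Sum>k\<in>{i<..n}. a k * U k)"
    by (metis (no_types, lifting) Un_commute finite_greaterThanAtMost greaterThanAtMost_iff insert_is_Un less_irrefl sum.insert)
  then have a: "a i * U i = (\<Sum>k\<in>{i..n}. a k * U k) - (\<Sum>k\<in>{i<..n}. a k * U k)"
    by simp
  have "(if i = 0 then 0 else right_quotient q n a u (i - 1)) * U i = (\<Sum>k\<in>{i..n}. a k * U k)"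
  proof (cases i)
    \<comment> \<open>Here \<open>root\<close> enters: the full sum is the remainder of the division
      and vanishes.\<close>
    case 0
    then show ?thesis
      using root by (simp add: U_def atMost_atLeast0)
  next
    case (Suc j)
    moreover have "{j<..n} = {Suc j..n}" by auto
    ultimately show ?thesis
      using U(1)[of i] by (simp add: right_quotient_def U_def)
  qed
  moreover have "right_quotient q n a u i * sigma_K (q ^ i) u * U i = (\<Sum>k\<in>{i<..n}. a k * U k)"
    using U(1)[of "Suc i"] U(2)[of i] unfolding right_quotient_def U_def[symmetric] by (simp add: mult_ac)
  ultimately have "a i * U i = ((if i = 0 then 0 else right_quotient q n a u (i - 1)) -
      right_quotient q n a u i * sigma_K (q ^ i) u) * U i"
    using a by (simp add: left_diff_distrib)
  then show ?thesis
    using U(1)[of i] by simp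
qed

text \<open>The bound is real because the lines considered may have any real slope. Zero series are
  set apart since \<open>fls_subdegree\<close> gives them 0 instead of infinity.\<close>

lemma subdegree_diff_ge:
  fixes f g :: "'a::group_add fls"
  assumes "f \<noteq> 0 \<Longrightarrow> r \<le> real_of_int (fls_subdegree f)" "g \<noteq> 0 \<Longrightarrow> r \<le> real_of_int (fls_subdegree g)" "f - g \<noteq> 0"
  shows "r \<le> real_of_int (fls_subdegree (f - g))"
proof -
  have "fls_nth (f - g) (fls_subdegree (f - g)) \<noteq> 0"
    using assms(3) by (rule nth_fls_subdegree_nonzero)
  then have "fls_nth f (fls_subdegree (f - g)) \<noteq> 0 \<or> fls_nth g (fls_subdegree (f - g)) \<noteq> 0"
    by auto
  then show ?thesis
  proof
    assume nz: "fls_nth f (fls_subdegree (f - g)) \<noteq> 0"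
    then have "f \<noteq> 0" by auto
    with assms(1) fls_subdegree_leI[OF nz] show ?thesis by linarith
  next
    assume nz: "fls_nth g (fls_subdegree (f - g)) \<noteq> 0"
    then have "g \<noteq> 0" by auto
    with assms(2) fls_subdegree_leI[OF nz] show ?thesis by linarith
  qed
qed

text \<open>Multiplying on the right by \<open>\<sigma> - u\<close> adds to the Newton polygon an edge of integral slope and
  leaves the lines of any other slope with as many contacts as before, up to a shift.\<close>

lemma integral_slopes_right_factor:
  assumes slopes: "integral_slopes (Suc n) a" and q: "q \<noteq> 0" and u: "u \<noteq> 0"
    and b: "\<And>i. i \<le> Suc n \<Longrightarrow> a i = (if i = 0 then 0 else b (i - 1)) - b i * sigma_K (q ^ i) u"
    and b_top: "b (Suc n) = 0"
  shows "integral_slopes n b"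
  unfolding integral_slopes_def
proof (intro allI ballI impI)
  fix \<mu> i j assume ij: "i \<in> newton_contacts n b \<mu>" "j \<in> newton_contacts n b \<mu>" "i \<noteq> j"
  define k where "k = fls_subdegree u"
  define v where "v f = real_of_int (fls_subdegree f)" for f :: "complex fls"
  define m where "m = v (b i) - \<mu> * i"
  have sigma_u: "sigma_K (q ^ t) u \<noteq> 0" for t
    using q u by (simp add: sigma_K_eq_0_iff)
  have v_b: "v (b t * sigma_K (q ^ t) u) = v (b t) + k" if "b t \<noteq> 0" for t
    using that sigma_u q by (simp add: v_def k_def subdegree_sigma_K)
  have b_ge: "v (b t) \<ge> m + \<mu> * t" if "t \<le> Suc n" "b t \<noteq> 0" for t
  proof -
    have "t \<le> n"
      using that b_top by (cases "t = Suc n") auto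
    with ij(1) that(2) have "v (b i) - \<mu> * i \<le> v (b t) - \<mu> * t"
      by (simp add: newton_contacts_def v_def)
    then show ?thesis by (simp add: m_def)
  qed
  have contact: "v (b s) = m + \<mu> * s" "b s \<noteq> 0" "s \<le> n" if "s \<in> {i, j}" for s
    using that ij unfolding newton_contacts_def m_def v_def by force+
  \<comment> \<open>Along slope \<mu>, the terms b(t-1) and b(t) \<sigma>^t(u) have intercepts at
    least m - \<mu> and m + k.\<close>
  have a_ge: "v (a t) \<ge> min (m - \<mu>) (m + k) + \<mu> * t" if "t \<le> Suc n" "a t \<noteq> 0" for t
    unfolding v_def b[OF that(1)]
  proof (rule subdegree_diff_ge; (fold v_def)?)
    assume "(if t = 0 then 0 else b (t - 1)) \<noteq> 0"
    then have t: "t > 0" "b (t - 1) \<noteq> 0"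
      by (auto split: if_splits)
    with that have "m + \<mu> * real (t - 1) \<le> v (b (t - 1))"
      by (intro b_ge) auto
    moreover have "min (m - \<mu>) (m + k) \<le> m - \<mu>" by simp
    ultimately show "min (m - \<mu>) (m + k) + \<mu> * t \<le> v (if t = 0 then 0 else b (t - 1))"
      using t(1) by (simp add: of_nat_diff algebra_simps del: min_le_iff_disj)
  next
    assume "b t * sigma_K (q ^ t) u \<noteq> 0"
    then show "min (m - \<mu>) (m + k) + \<mu> * t \<le> v (b t * sigma_K (q ^ t) u)"
      using b_ge[of t] that v_b[of t] by auto
  qed (use that b in auto)
  \<comment> \<open>-k is the slope of \<sigma> - u. For -\<mu> < k the term b(i-1) dominates on the
    touching line and contacts move from s to s + 1; for k < -\<mu> the term b(i) \<sigma>^i(u)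
    dominates and they stay.\<close>
  consider "\<mu> = - k" | "- \<mu> < k" | "k < - \<mu>" by linarith
  then show "\<mu> \<in> \<int>"
  proof cases
    case 2
    have "Suc s \<in> newton_contacts (Suc n) a \<mu>" if "s \<in> {i, j}" for s
    proof -
      note s = contact[OF that]
      have a_s: "a (Suc s) = b s - b (Suc s) * sigma_K (q ^ Suc s) u"
        using b[of "Suc s"] s by simp
      have "a (Suc s) \<noteq> 0 \<and> v (a (Suc s)) = v (b s)"
      proof (cases "b (Suc s) = 0")
        case False
        have "v (b s) < v (b (Suc s) * sigma_K (q ^ Suc s) u)"
          unfolding v_b[OF False] using b_ge[of "Suc s"] False s 2 by (simp add: algebra_simps)
        then have lt: "fls_subdegree (b s) < fls_subdegree (b (Suc s) * sigma_K (q ^ Suc s) u)"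
          by (simp add: v_def)
        then have "v (a (Suc s)) = v (b s)"
          unfolding a_s v_def using s by (subst fls_subdegree_diff_eq1) auto
        moreover have "a (Suc s) \<noteq> 0"
          unfolding a_s using lt by auto
        ultimately show ?thesis by simp
      qed (use a_s s in simp)
      then have "a (Suc s) \<noteq> 0" "v (a (Suc s)) - \<mu> * Suc s = m - \<mu>"
        using s by (simp_all add: algebra_simps)
      moreover have "m - \<mu> \<le> v (a t) - \<mu> * t" if "t \<le> Suc n" "a t \<noteq> 0" for t
        using a_ge[OF that] 2 by (simp add: min_def split: if_splits)
      ultimately show ?thesis
        using s unfolding newton_contacts_def v_def by auto
    qed
    with ij(3) slopes show ?thesis
      unfolding integral_slopes_def by (metis insertCI nat.inject)
  next
    case 3
    have "s \<in> newton_contacts (Suc n) a \<mu>" if "s \<in> {i, j}" for s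
    proof -
      note s = contact[OF that]
      have a_s: "a s = (if s = 0 then 0 else b (s - 1)) - b s * sigma_K (q ^ s) u"
        using b[of s] s by simp
      have "a s \<noteq> 0 \<and> v (a s) = v (b s) + k"
      proof (cases "s = 0 \<or> b (s - 1) = 0")
        case False
        have "m + \<mu> * real (s - 1) \<le> v (b (s - 1))"
          using False s by (intro b_ge) auto
        then have "v (b s * sigma_K (q ^ s) u) < v (b (s - 1))"
          unfolding v_b[OF s(2)] using False s 3 by (simp add: algebra_simps of_nat_diff)
        then have lt: "fls_subdegree (b s * sigma_K (q ^ s) u) < fls_subdegree (b (s - 1))"
          by (simp add: v_def)
        then have "v (a s) = v (b s * sigma_K (q ^ s) u)"
          unfolding a_s v_def using False s sigma_u by (subst fls_subdegree_diff_eq2) auto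
        moreover have "a s \<noteq> 0"
          unfolding a_s using lt False by auto
        ultimately show ?thesis
          using v_b[OF s(2)] by simp
      next
        case True
        then have "a s = - (b s * sigma_K (q ^ s) u)"
          using a_s by auto
        then show ?thesis
          using v_b[OF s(2)] s sigma_u by (simp add: v_def)
      qed
      then have "a s \<noteq> 0" "v (a s) - \<mu> * s = m + k"
        using s by simp_all
      moreover have "m + k \<le> v (a t) - \<mu> * t" if "t \<le> Suc n" "a t \<noteq> 0" for t
        using a_ge[OF that] 3 by (simp add: min_def split: if_splits)
      ultimately show ?thesis
        using s unfolding newton_contacts_def v_def by auto
    qed
    with ij(3) slopes show ?thesis
      unfolding integral_slopes_def by (metis insertCI)
  qed simp
qed


section \<open>Solutions modulo the ideal of relations\<close>

definition qdiff_poly :: "complex \<Rightarrow> nat \<Rightarrow> (nat \<Rightarrow> complex fls) \<Rightarrow> K_poly \<Rightarrow> K_poly" where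
  "qdiff_poly q n a f = (\<Sum>i\<le>n. of_K (a i) * (sigma_poly q ^^ i) f)"

lemma sigma_poly_iterate_of_K_mult:
  assumes "q \<noteq> 0"
  shows "(sigma_poly q ^^ i) (of_K x * f) = of_K (sigma_K (q ^ i) x) * (sigma_poly q ^^ i) f"
  by (induction i) (use assms in \<open>simp_all add: sigma_K_by_1 sigma_poly_mult sigma_K_compose\<close>)

lemma sigma_poly_iterate_diff:
  "q \<noteq> 0 \<Longrightarrow> (sigma_poly q ^^ i) (f - g) = (sigma_poly q ^^ i) f - (sigma_poly q ^^ i) g"
  by (induction i) (simp_all add: sigma_poly_diff)

lemma qdiff_poly_cong_L:
  assumes "q \<noteq> 0" "cong_L q f g"
  shows "cong_L q (qdiff_poly q n a f) (qdiff_poly q n a g)"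
proof -
  have "cong_L q ((sigma_poly q ^^ i) f) ((sigma_poly q ^^ i) g)" for i
    by (induction i) (use assms in \<open>simp_all add: sigma_poly_cong_L\<close>)
  then show ?thesis
    unfolding qdiff_poly_def by (intro cong_L_sum cong_L_mult_left)
qed

lemma qdiff_poly_factor:
  assumes q: "q \<noteq> 0"
    and b: "\<And>i. i \<le> Suc n \<Longrightarrow> a i = (if i = 0 then 0 else b (i - 1)) - b i * sigma_K (q ^ i) u"
    and b_top: "b (Suc n) = 0"
  shows "qdiff_poly q (Suc n) a f = qdiff_poly q n b (sigma_poly q f - of_K u * f)"
proof -
  have "qdiff_poly q (Suc n) a f =
      (\<Sum>i\<le>Suc n. of_K (if i = 0 then 0 else b (i - 1)) * (sigma_poly q ^^ i) f) -
      (\<Sum>i\<le>Suc n. of_K (b i * sigma_K (q ^ i) u) * (sigma_poly q ^^ i) f)"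
    unfolding qdiff_poly_def sum_subtractf[symmetric]
    by (rule sum.cong[OF refl]) (simp only: b atMost_iff of_K_diff left_diff_distrib)
  also have "(\<Sum>i\<le>Suc n. of_K (if i = 0 then 0 else b (i - 1)) * (sigma_poly q ^^ i) f) =
      (\<Sum>i\<le>n. of_K (b i) * (sigma_poly q ^^ Suc i) f)"
    by (subst sum.atMost_Suc_shift) simp
  also have "(\<Sum>i\<le>Suc n. of_K (b i * sigma_K (q ^ i) u) * (sigma_poly q ^^ i) f) =
      (\<Sum>i\<le>n. of_K (b i) * (of_K (sigma_K (q ^ i) u) * (sigma_poly q ^^ i) f))"
    by (simp add: b_top of_K_mult mult.assoc)
  also have "(\<Sum>i\<le>n. of_K (b i) * (sigma_poly q ^^ Suc i) f) - \<dots> =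
      qdiff_poly q n b (sigma_poly q f - of_K u * f)"
    using q by (simp add: qdiff_poly_def sigma_poly_iterate_diff sigma_poly_iterate_of_K_mult
        right_diff_distrib sum_subtractf funpow_swap1)
  finally show ?thesis .
qed

text \<open>Stands for the span in L over the constants; a coefficient is a polynomial whose class
  \<sigma> fixes. The recursion copies that of \<open>Span\<close>, so the transfer to L is an
  induction on the list.\<close>

fun poly_span :: "complex \<Rightarrow> K_poly list \<Rightarrow> K_poly set" where
  "poly_span q [] = L_ideal q"
| "poly_span q (f # fs) =
     {p. \<exists>c r. cong_L q (sigma_poly q c) c \<and> r \<in> poly_span q fs \<and> cong_L q p (c * f + r)}"

fun poly_independent :: "complex \<Rightarrow> K_poly list \<Rightarrow> bool" where
  "poly_independent q [] \<longleftrightarrow> True"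
| "poly_independent q (f # fs) \<longleftrightarrow> f \<notin> poly_span q fs \<and> poly_independent q fs"

lemma poly_span_cong_L: "cong_L q p p' \<Longrightarrow> p \<in> poly_span q fs \<Longrightarrow> p' \<in> poly_span q fs"
proof (cases fs)
  case Nil
  assume "cong_L q p p'" "p \<in> poly_span q fs"
  with Nil show ?thesis
    using L_ideal_add[of "p' - p" q p] cong_L_sym[of q p p'] by (simp add: cong_L_def)
next
  case (Cons f fs')
  assume "cong_L q p p'" "p \<in> poly_span q fs"
  with Cons show ?thesis
    by (auto intro: cong_L_trans[OF cong_L_sym])
qed

lemma mem_L_ideal_iff: "p \<in> L_ideal q \<longleftrightarrow> cong_L q p 0"
  by (simp add: cong_L_def)

text \<open>\<sigma> - u commutes with constants and kills \<open>y\<close>, so it turns a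
  combination of \<open>gs\<close> and \<open>y\<close> into the same combination of
  \<open>fs\<close>. With \<open>y\<close> last in the list, its term is the base case.\<close>

lemma first_order_span:
  assumes q: "q \<noteq> 0" and y: "sigma_poly q y = of_K u * y"
    and gs: "list_all2 (\<lambda>g f. cong_L q (sigma_poly q g - of_K u * g) f) gs fs"
    and p: "p \<in> poly_span q (gs @ [y])"
  shows "sigma_poly q p - of_K u * p \<in> poly_span q fs"
  using gs p
proof (induction gs fs arbitrary: p rule: list_all2_induct)
  case Nil
  then obtain c r where c: "cong_L q (sigma_poly q c) c" and r: "r \<in> L_ideal q"
    and p: "cong_L q p (c * y + r)"
    by auto
  from r have "cong_L q p (c * y)"
    using cong_L_trans[OF p cong_L_add[of q "c * y" "c * y" r 0]] by (simp add: mem_L_ideal_iff)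
  then have "cong_L q (sigma_poly q p - of_K u * p) (sigma_poly q (c * y) - of_K u * (c * y))"
    using q by (intro cong_L_diff cong_L_mult_left sigma_poly_cong_L)
  also have "\<dots> = of_K u * y * (sigma_poly q c - c)"
    using q by (simp add: sigma_poly_mult y algebra_simps)
  also have "cong_L q \<dots> (of_K u * y * (c - c))"
    using c by (intro cong_L_mult_left cong_L_diff cong_L_refl)
  finally show ?case
    by (simp add: mem_L_ideal_iff)
next
  case (Cons g gs f fs)
  then obtain c r where c: "cong_L q (sigma_poly q c) c" and r: "r \<in> poly_span q (gs @ [y])"
    and p: "cong_L q p (c * g + r)"
    by auto
  have "cong_L q (sigma_poly q p - of_K u * p) (sigma_poly q (c * g + r) - of_K u * (c * g + r))"
    using q p by (intro cong_L_diff cong_L_mult_left sigma_poly_cong_L)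
  also have "\<dots> = sigma_poly q c * sigma_poly q g - c * (of_K u * g) + (sigma_poly q r - of_K u * r)"
    using q by (simp add: sigma_poly_add sigma_poly_mult algebra_simps)
  also have "cong_L q \<dots> (c * sigma_poly q g - c * (of_K u * g) + (sigma_poly q r - of_K u * r))"
    using c by (intro cong_L_add cong_L_diff cong_L_mult cong_L_refl)
  also have "\<dots> = c * (sigma_poly q g - of_K u * g) + (sigma_poly q r - of_K u * r)"
    by (simp add: right_diff_distrib)
  also have "cong_L q \<dots> (c * f + (sigma_poly q r - of_K u * r))"
    using Cons.hyps by (intro cong_L_add cong_L_mult_left cong_L_refl) auto
  finally show ?case
    using c Cons.IH[OF r] by auto
qed

lemma first_order_independent:
  assumes q: "q \<noteq> 0" and y: "sigma_poly q y = of_K u * y" "y \<notin> L_ideal q"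
    and gs: "list_all2 (\<lambda>g f. cong_L q (sigma_poly q g - of_K u * g) f) gs fs"
    and fs: "poly_independent q fs"
  shows "poly_independent q (gs @ [y])"
  using gs fs
proof (induction gs fs rule: list_all2_induct)
  case (Cons g gs f fs)
  have "g \<notin> poly_span q (gs @ [y])"
  proof
    assume "g \<in> poly_span q (gs @ [y])"
    with first_order_span[OF q y(1)] Cons.hyps have "sigma_poly q g - of_K u * g \<in> poly_span q fs"
      by blast
    with Cons.hyps have "f \<in> poly_span q fs"
      by (blast intro: poly_span_cong_L)
    with Cons.prems show False by simp
  qed
  with Cons show ?case by simp
qed (simp add: y)

section \<open>Induction on the order of the operator\<close>

lemma first_order_unit_solution:
  assumes q: "norm q > 1" and c: "c \<noteq> 0" and g: "g \<noteq> 0"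
  obtains y y' where
    "sigma_poly q y = of_K (fls_const c * fls_X powi k * sigma_K q g / g) * y" "cong_L q (y * y') 1"
proof -
  have q0: "q \<noteq> 0" using q by auto
  \<comment> \<open>Splits \<open>k\<close> into two natural exponents, at most one of them nonzero.
    Exchanging them inverts the power of \<Theta>.\<close>
  define a b where "a = nat k" and "b = nat (- k)"
  have k: "int a - int b = k" by (simp add: a_def b_def)
  define y where "y = of_K g * L_monomial c a b"
  define y' where "y' = of_K (inverse g) * L_monomial (inverse c) b a"
  have "sigma_poly q y = of_K (fls_const c * fls_X powi k * sigma_K q g) * L_monomial c a b"
    using q0 c k by (simp add: y_def sigma_poly_mult sigma_poly_L_monomial of_K_mult mult_ac)
  also have "\<dots> = of_K (fls_const c * fls_X powi k * sigma_K q g / g * g) * L_monomial c a b"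
    using g by simp
  also have "\<dots> = of_K (fls_const c * fls_X powi k * sigma_K q g / g) * y"
    by (simp only: y_def of_K_mult mult_ac)
  finally have y: "sigma_poly q y = of_K (fls_const c * fls_X powi k * sigma_K q g / g) * y" .
  have "cong_L q ((indet Theta * indet ThetaInv) ^ m) 1" for m
  proof (induction m)
    case (Suc m)
    from cong_L_mult[OF cong_L_Theta Suc] show ?case by simp
  qed simp
  moreover have "cong_L q (e_symb c * e_symb (inverse c)) 1"
    using cong_L_trans[OF cong_L_e_mult[of c "inverse c" q]] cong_L_e_1[of q] c by simp
  ultimately have "cong_L q (of_K (g * inverse g) * (e_symb c * e_symb (inverse c)) *
      (indet Theta * indet ThetaInv) ^ (a + b)) (1 * 1 * 1)"
    using g by (intro cong_L_mult) simp_all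
  moreover have "y * y' = of_K (g * inverse g) * (e_symb c * e_symb (inverse c)) *
      (indet Theta * indet ThetaInv) ^ (a + b)"
    by (simp only: y_def y'_def L_monomial_def of_K_mult power_add power_mult_distrib mult_ac)
  ultimately show ?thesis
    using that[OF y, of y'] by (simp only: mult_1)
qed

lemma qdiff_poly_solutions:
  assumes q: "norm q > 1"
  shows "a 0 \<noteq> 0 \<Longrightarrow> a n \<noteq> 0 \<Longrightarrow> integral_slopes n a \<Longrightarrow>
    \<exists>fs. length fs = n \<and> (\<forall>f\<in>set fs. cong_L q (qdiff_poly q n a f) 0) \<and> poly_independent q fs"
proof (induction n arbitrary: a)
  case 0
  show ?case by (rule exI[of _ "[]"]) simp
next
  case (Suc n)
  have q0: "q \<noteq> 0" using q by auto
  obtain \<mu> i where i: "0 \<in> newton_contacts (Suc n) a \<mu>" "i \<in> newton_contacts (Suc n) a \<mu>" "i \<noteq> 0"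
    using newton_contacts_exist[of a "Suc n"] Suc.prems by auto
  then have "\<mu> \<in> \<int>"
    using Suc.prems(3) unfolding integral_slopes_def by metis
  then obtain k where "\<mu> = of_int k" by (rule Ints_cases)
  with i obtain c g where c: "c \<noteq> 0" and g: "g \<noteq> 0" and root:
    "(\<Sum>i\<le>Suc n. a i * sigma_prod q (fls_const c * fls_X powi (- k) * sigma_K q g / g) i) = 0"
    using first_order_right_factor[OF q, of 0 "Suc n" a k i] by metis
  define u where "u = fls_const c * fls_X powi (- k) * sigma_K q g / g"
  have u: "u \<noteq> 0"
    using c g q0 by (simp add: u_def sigma_K_eq_0_iff)
  define b where "b = right_quotient q (Suc n) a u"
  have b: "a i = (if i = 0 then 0 else b (i - 1)) - b i * sigma_K (q ^ i) u" if "i \<le> Suc n" for i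
    using right_quotient[OF q0 u root[folded u_def] that] by (simp add: b_def)
  have b_top: "b (Suc n) = 0"
    by (simp add: b_def right_quotient_ge)
  \<comment> \<open>The end coefficients of P = Q (\<sigma> - u) are -b(0) u and b(n).\<close>
  have "b 0 \<noteq> 0" "b n \<noteq> 0"
    using b[of 0] b[of "Suc n"] b_top Suc.prems by auto
  moreover have "integral_slopes n b"
    using Suc.prems(3) q0 u b b_top by (rule integral_slopes_right_factor)
  ultimately obtain fs where fs: "length fs = n" "\<forall>f\<in>set fs. cong_L q (qdiff_poly q n b f) 0"
    "poly_independent q fs"
    using Suc.IH by blast
  obtain y y' where y: "sigma_poly q y = of_K u * y" "cong_L q (y * y') 1"
    using first_order_unit_solution[OF q c g, of "- k"] unfolding u_def by blast
  have "y \<notin> L_ideal q"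
  proof
    assume "y \<in> L_ideal q"
    then have "cong_L q (y' * y) (y' * 0)"
      by (intro cong_L_mult_left) (simp add: mem_L_ideal_iff)
    then have "cong_L q 1 0"
      using cong_L_trans[OF cong_L_sym[OF y(2)]] by (simp add: mult.commute)
    with one_notin_L_ideal[OF q] show False
      by (simp add: mem_L_ideal_iff)
  qed
  obtain G where G: "cong_L q (sigma_poly q (G f) - of_K u * G f) f" for f
    using first_order_surj[OF q u y] by metis
  define gs where "gs = map G fs"
  have "list_all2 (\<lambda>g f. cong_L q (sigma_poly q g - of_K u * g) f) gs fs"
    by (simp add: gs_def list_all2_map1 list_all2_same G)
  then have "poly_independent q (gs @ [y])"
    using first_order_independent[OF q0 y(1) \<open>y \<notin> L_ideal q\<close>] fs(3) by blast
  moreover have "cong_L q (qdiff_poly q (Suc n) a f) 0" if f: "f \<in> set (gs @ [y])" for f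
  proof -
    have factor: "qdiff_poly q (Suc n) a f = qdiff_poly q n b (sigma_poly q f - of_K u * f)"
      using q0 b b_top by (rule qdiff_poly_factor)
    consider f' where "f' \<in> set fs" "f = G f'" | "f = y"
      using f by (auto simp: gs_def)
    then show ?thesis
    proof cases
      case 1
      have "cong_L q (qdiff_poly q (Suc n) a f) (qdiff_poly q n b f')"
        unfolding factor unfolding 1(2) using q0 G by (rule qdiff_poly_cong_L)
      also have "cong_L q \<dots> 0"
        using fs(2) 1 by blast
      finally show ?thesis .
    next
      case 2
      have "(sigma_poly q ^^ i) 0 = 0" for i
        by (induction i) simp_all
      then show ?thesis
        unfolding factor unfolding 2 y by (simp add: qdiff_poly_def)
    qed
  qed
  moreover have "length (gs @ [y]) = Suc n"
    using fs(1) by (simp add: gs_def)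
  ultimately show ?case by blast
qed


section \<open>Passage to the quotient\<close>

lemma ideal_L_ideal: "ideal (L_ideal q) K_poly_ring"
  by (simp add: ideal_ring_of_type_algebra_iff type_ideal_L_ideal)

lemma ring_L_ring: "ring (L_ring q)"
  unfolding L_ring_def by (rule ideal.quotient_is_ring[OF ideal_L_ideal])

lemma to_L_eq: "to_L q p = {x. cong_L q x p}"
proof -
  have "x \<in> to_L q p" if "cong_L q x p" for x
    using that unfolding to_L_def a_r_coset_def' cong_L_def
    by (auto simp: ring_of_type_algebra_def intro!: bexI[of _ "x - p"])
  then show ?thesis
    unfolding to_L_def a_r_coset_def' cong_L_def by (auto simp: ring_of_type_algebra_def)
qed

lemma to_L_eq_iff: "to_L q p = to_L q p' \<longleftrightarrow> cong_L q p p'"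
  unfolding to_L_eq using cong_L_refl cong_L_sym cong_L_trans by blast

lemma carrier_L_ring: "carrier (L_ring q) = range (to_L q)"
  unfolding L_ring_def FactRing_def A_RCOSETS_def' to_L_def by (auto simp: ring_of_type_algebra_def)

lemma to_L_mult: "to_L q x \<otimes>\<^bsub>L_ring q\<^esub> to_L q y = to_L q (x * y)"
  and to_L_add: "to_L q x \<oplus>\<^bsub>L_ring q\<^esub> to_L q y = to_L q (x + y)"
proof -
  have hom: "to_L q \<in> ring_hom K_poly_ring (L_ring q)"
    unfolding to_L_def[abs_def] L_ring_def by (rule ideal.rcos_ring_hom[OF ideal_L_ideal])
  show "to_L q x \<otimes>\<^bsub>L_ring q\<^esub> to_L q y = to_L q (x * y)"
    using ring_hom_mult[OF hom, of x y] by (simp add: ring_of_type_algebra_def)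
  show "to_L q x \<oplus>\<^bsub>L_ring q\<^esub> to_L q y = to_L q (x + y)"
    using ring_hom_add[OF hom, of x y] by (simp add: ring_of_type_algebra_def)
qed

lemma zero_L_ring: "\<zero>\<^bsub>L_ring q\<^esub> = to_L q 0"
  by (auto simp: L_ring_def FactRing_def to_L_eq mem_L_ideal_iff)

lemma to_L_sum: "finite A \<Longrightarrow> (\<Oplus>\<^bsub>L_ring q\<^esub>i\<in>A. to_L q (f i)) = to_L q (\<Sum>i\<in>A. f i)"
proof (induction A rule: finite_induct)
  interpret ring "L_ring q" by (rule ring_L_ring)
  case empty
  show ?case by (simp add: zero_L_ring)
next
  interpret ring "L_ring q" by (rule ring_L_ring)
  case (insert i A)
  then show ?case by (simp add: carrier_L_ring to_L_add)
qed

lemma sigma_L_to_L: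
  assumes "q \<noteq> 0"
  shows "sigma_L q (to_L q p) = to_L q (sigma_poly q p)"
proof -
  have "to_L q (sigma_poly q p') = to_L q (sigma_poly q p)" if "p' \<in> to_L q p" for p'
    using that sigma_poly_cong_L[OF assms] by (simp add: to_L_eq_iff) (simp add: to_L_eq)
  moreover have "p \<in> to_L q p"
    by (simp add: to_L_eq)
  ultimately show ?thesis
    unfolding sigma_L_def by blast
qed

lemma qdiff_apply_to_L:
  assumes "q \<noteq> 0"
  shows "qdiff_apply q n a (to_L q f) = to_L q (qdiff_poly q n a f)"
proof -
  have "(sigma_L q ^^ i) (to_L q f) = to_L q ((sigma_poly q ^^ i) f)" for i
    by (induction i) (simp_all add: sigma_L_to_L assms)
  then show ?thesis
    by (simp add: qdiff_apply_def qdiff_poly_def to_L_mult to_L_sum)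
qed

lemma poly_span_if_to_L_mem_Span:
  assumes q: "q \<noteq> 0"
  shows "to_L q p \<in> ring.Span (L_ring q) (constants_L q) (map (to_L q) fs) \<Longrightarrow> p \<in> poly_span q fs"
proof (induction fs arbitrary: p)
  interpret ring "L_ring q" by (rule ring_L_ring)
  case Nil
  then show ?case by (simp add: zero_L_ring to_L_eq_iff mem_L_ideal_iff)
next
  interpret ring "L_ring q" by (rule ring_L_ring)
  case (Cons f fs)
  then obtain k v where k: "k \<in> constants_L q" and v: "v \<in> Span (constants_L q) (map (to_L q) fs)"
    and p: "to_L q p = k \<otimes>\<^bsub>L_ring q\<^esub> to_L q f \<oplus>\<^bsub>L_ring q\<^esub> v"
    by (auto simp: line_extension_mem_iff)
  obtain c where c: "k = to_L q c"
    using k by (auto simp: constants_L_def carrier_L_ring)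
  have sub: "constants_L q \<subseteq> carrier (L_ring q)"
    by (auto simp: constants_L_def)
  have "Span (constants_L q) (map (to_L q) gs) \<subseteq> carrier (L_ring q)" for gs
    by (induction gs) (use line_extension_in_carrier[OF sub] in \<open>auto simp: carrier_L_ring zero_L_ring\<close>)
  with v obtain r where r: "v = to_L q r"
    by (auto simp: carrier_L_ring)
  have "cong_L q (sigma_poly q c) c"
    using k q by (simp add: c constants_L_def sigma_L_to_L to_L_eq_iff)
  moreover have "r \<in> poly_span q fs"
    using Cons.IH v r by blast
  moreover have "cong_L q p (c * f + r)"
    using p by (simp add: c r to_L_mult to_L_add to_L_eq_iff)
  ultimately show ?case by auto
qed

lemma independent_if_poly_independent:
  assumes "q \<noteq> 0"
  shows "poly_independent q fs \<Longrightarrow> ring.independent (L_ring q) (constants_L q) (map (to_L q) fs)"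
proof (induction fs)
  interpret ring "L_ring q" by (rule ring_L_ring)
  case Nil
  show ?case by simp
next
  interpret ring "L_ring q" by (rule ring_L_ring)
  case (Cons f fs)
  then show ?case
    using poly_span_if_to_L_mem_Span[OF assms] by (auto intro!: li_Cons simp: carrier_L_ring simp del: Span.simps)
qed

theorem mainTheorem4:
  fixes q :: complex and n :: nat and a :: "nat \<Rightarrow> complex fls"
  assumes "norm q > 1"
    and "a 0 * a n \<noteq> 0"
    and "slopes n a \<subseteq> \<int>"
  shows "\<exists>fs. length fs = n \<and>
           (\<forall>f\<in>set fs. f \<in> carrier (L_ring q) \<and> qdiff_apply q n a f = \<zero>\<^bsub>L_ring q\<^esub>) \<and>
           ring.independent (L_ring q) (constants_L q) fs"
proof -
  have q0: "q \<noteq> 0" using assms(1) by auto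
  have "integral_slopes n a"
    unfolding integral_slopes_def using newton_contacts_slope assms(3) by blast
  then obtain fs where fs: "length fs = n" "\<forall>f\<in>set fs. cong_L q (qdiff_poly q n a f) 0"
    "poly_independent q fs"
    using qdiff_poly_solutions[OF assms(1)] assms(2) by (metis mult_eq_0_iff)
  show ?thesis
  proof (intro exI[of _ "map (to_L q) fs"] conjI ballI)
    show "ring.independent (L_ring q) (constants_L q) (map (to_L q) fs)"
      using q0 fs(3) by (rule independent_if_poly_independent)
  next
    fix f assume "f \<in> set (map (to_L q) fs)"
    then obtain p where "p \<in> set fs" "f = to_L q p"
      by auto
    with fs(2) q0 show "f \<in> carrier (L_ring q)" "qdiff_apply q n a f = \<zero>\<^bsub>L_ring q\<^esub>"
      by (auto simp: carrier_L_ring qdiff_apply_to_L zero_L_ring to_L_eq_iff)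
  qed (simp add: fs(1))
qed

end
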